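(* Fix $a>0$ and consider the class of all functions $\Phi$ of the finite-endpoint or infinite-endpoint form described in the context, with first-lobe maximum point $u_1$, maximum value $A=\Phi(u_1)$, and inverse moment $I$. These satisfy $$\text{(E)}\ \ \frac{\Phi(tu_1)}A\ge t^{a/2}\left(1+\frac a2(1-t)\right)\ \ \left(0\le t\le1+\tfrac2a\right),\qquad \text{(M)}\ \ \int_0^{u_1}\frac{\Phi(u)^2}u\,du\ge\frac{A^2}aR(a),$$ and, whenever $I<\infty$, (P) $A^2<aI/R_*(a)$. Then: (1) The bound (E) is pointwise best possible: for each $t\in[0,1+2/a]$ its right-hand side cannot be replaced by a larger number valid for the whole class. (2) $R(a)$ is the largest universal constant in (M). Equality in (M) holds precisely when $\lambda=0$, the product has exactly one factor, and, in the finite-endpoint case, $b=0$. (3) The constant $R_*(a)$ in (P) is best possible over the class (it cannot be replaced by a larger constant), although equality $A^2=aI/R_*(a)$ is never attained. Here optimality is for the union of the finite- and infinite-endpoint cases; an extremizing sequence for (3) already lies in the finite-endpoint family with one zero ($N=1$). No optimality assertion is made for the infinite-endpoint subclass considered by itself.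
   Context: Class of functions, for $a>0$, $\lambda\ge0$, $C>0$. Finite endpoint: there are $B>0$, $b\ge0$, an integer $N\ge1$ and $0<\zeta_1<\cdots<\zeta_N<B$ with $\Phi(u)=C u^{a/2}(B-u)^{b/2}e^{-\lambda u/2}\prod_{j=1}^N(1-u/\zeta_j)$ for $0<u<B$; put $L=B$. Infinite endpoint: $\Phi(u)=C u^{a/2}e^{-\lambda u/2}\prod_{j\in\mathcal J}(1-u/\zeta_j)$ on $(0,\infty)$, with $\mathcal J$ finite or countable, $0<\zeta_1<\zeta_2<\cdots$ if the product is nonempty, $\sum_j\zeta_j^{-1}<\infty$ in the countably infinite case, and the empty product allowed if $\lambda>0$; put $L=\infty$. If the product is empty, $\zeta_1=\infty$. In all cases $\Phi(0)=0$ by continuous extension. $\Phi$ has a unique maximum point $u_1$ on $(0,\zeta_1)$, $A=\Phi(u_1)$, and $I=\int_0^L\Phi(u)^2u^{-1}\,du$. The constants are $$R(a)=\frac{5a^2+10a+4}{2(a+1)(a+2)},\qquad R_*(a)=\frac{a+2}{2(a+1)}\left(\frac{a+2}a\right)^a.$$ *)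

theory Defs
  imports "HOL-Analysis.Analysis"
begin

text \<open>
  Zeros are indexed from 0: the paper's \<open>\<zeta>\<^sub>j\<close> is \<open>\<zeta> (j - 1)\<close>. Values of \<open>\<zeta>\<close> beyond the number
  of factors are irrelevant. The exponent \<open>a\<close> is common to the whole class and therefore not
  part of the data. The variable \<open>lam\<close> is the paper's \<open>\<lambda>\<close>.

  \<open>Finite_Endpoint C lam B b N \<zeta>\<close> and \<open>Infinite_Endpoint C lam N \<zeta>\<close>, where in the latter
  \<open>N = 0\<close> is the empty product and \<open>N = \<infinity>\<close> the countably infinite one.
\<close>

datatype lobe_data =
    Finite_Endpoint real real real real nat "nat \<Rightarrow> real"
  | Infinite_Endpoint real real enat "nat \<Rightarrow> real"

fun admissible :: "lobe_data \<Rightarrow> bool" where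
  "admissible (Finite_Endpoint C lam B b N \<zeta>) \<longleftrightarrow>
     C > 0 \<and> lam \<ge> 0 \<and> B > 0 \<and> b \<ge> 0 \<and> N \<ge> 1 \<and>
     (\<forall>j<N. 0 < \<zeta> j \<and> \<zeta> j < B) \<and> strict_mono_on {..<N} \<zeta>"
| "admissible (Infinite_Endpoint C lam N \<zeta>) \<longleftrightarrow>
     C > 0 \<and> lam \<ge> 0 \<and>
     (\<forall>j. enat j < N \<longrightarrow> 0 < \<zeta> j) \<and> strict_mono_on {j. enat j < N} \<zeta> \<and>
     (N = \<infinity> \<longrightarrow> summable (\<lambda>j. 1 / \<zeta> j)) \<and> (N = 0 \<longrightarrow> lam > 0)"

definition zero_product :: "enat \<Rightarrow> (nat \<Rightarrow> real) \<Rightarrow> real \<Rightarrow> real" where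
  "zero_product N \<zeta> u =
     (case N of enat n \<Rightarrow> (\<Prod>j<n. 1 - u / \<zeta> j) | \<infinity> \<Rightarrow> (\<Prod>j. 1 - u / \<zeta> j))"

text \<open>
  Only the values for \<open>0 \<le> u < L\<close> are meaningful; the value at \<open>0\<close> is the continuous extension
  \<open>0\<close>, because \<open>0 powr x = 0\<close>.
\<close>

fun Phi :: "real \<Rightarrow> lobe_data \<Rightarrow> real \<Rightarrow> real" where
  "Phi a (Finite_Endpoint C lam B b N \<zeta>) u =
     C * u powr (a / 2) * (B - u) powr (b / 2) * exp (- lam * u / 2) * (\<Prod>j<N. 1 - u / \<zeta> j)"
| "Phi a (Infinite_Endpoint C lam N \<zeta>) u =
     C * u powr (a / 2) * exp (- lam * u / 2) * zero_product N \<zeta> u"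

fun endpoint :: "lobe_data \<Rightarrow> ereal" where
  "endpoint (Finite_Endpoint C lam B b N \<zeta>) = ereal B"
| "endpoint (Infinite_Endpoint C lam N \<zeta>) = \<infinity>"

fun first_zero :: "lobe_data \<Rightarrow> ereal" where
  "first_zero (Finite_Endpoint C lam B b N \<zeta>) = ereal (\<zeta> 0)"
| "first_zero (Infinite_Endpoint C lam N \<zeta>) = (if N = 0 then \<infinity> else ereal (\<zeta> 0))"

definition max_point :: "real \<Rightarrow> lobe_data \<Rightarrow> real" where
  "max_point a p =
     (THE u. is_arg_max (Phi a p) (\<lambda>v. 0 < v \<and> ereal v < first_zero p) u)"

definition max_value :: "real \<Rightarrow> lobe_data \<Rightarrow> real" where
  "max_value a p = Phi a p (max_point a p)"

definition inverse_moment :: "real \<Rightarrow> lobe_data \<Rightarrow> ennreal" where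
  "inverse_moment a p =
     (\<integral>\<^sup>+u\<in>{u. 0 < u \<and> ereal u < endpoint p}. ennreal ((Phi a p u)\<^sup>2 / u) \<partial>lborel)"

definition partial_inverse_moment :: "real \<Rightarrow> lobe_data \<Rightarrow> real" where
  "partial_inverse_moment a p = (LBINT u:{0<..<max_point a p}. (Phi a p u)\<^sup>2 / u)"

definition R_const :: "real \<Rightarrow> real" where
  "R_const a = (5 * a\<^sup>2 + 10 * a + 4) / (2 * (a + 1) * (a + 2))"

definition R_star :: "real \<Rightarrow> real" where
  "R_star a = (a + 2) / (2 * (a + 1)) * ((a + 2) / a) powr a"

fun single_factor_form :: "lobe_data \<Rightarrow> bool" where
  "single_factor_form (Finite_Endpoint C lam B b N \<zeta>) \<longleftrightarrow> lam = 0 \<and> N = 1 \<and> b = 0"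
| "single_factor_form (Infinite_Endpoint C lam N \<zeta>) \<longleftrightarrow> lam = 0 \<and> N = 1"

end

theory Submission
  imports Defs
begin

text \<open>
  Write \<open>\<Phi>(u) = u powr (a / 2) * G u\<close>. Below the first zero, \<open>G\<close> is positive, decreasing,
  log-concave and convex. Log-concavity makes the maximum point \<open>u\<^sub>1\<close> unique, and \<open>\<Phi>'(u\<^sub>1) = 0\<close>
  says that the tangent to \<open>G\<close> at \<open>u\<^sub>1\<close> is \<open>G u\<^sub>1 * (1 + a / 2 * (1 - u / u\<^sub>1))\<close>. Convexity puts \<open>G\<close>
  above this line, which is (E); squaring and integrating up to \<open>u\<^sub>1\<close>, respectively up to the zero
  of the line, gives (M) and (P). The inequality (P) is strict because \<open>\<Phi>\<close> does not vanish
  identically beyond its first zero. Unless there is a single linear factor and nothing else, \<open>G\<close>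
  is strictly convex and (M) is strict; for a single factor \<open>G\<close> is its own tangent. Letting the
  endpoint decrease to the zero of that factor shows that \<open>R_star\<close> is optimal.
\<close>

section \<open>Decreasing log-concave functions\<close>

text \<open>With s = u / \<open>u\<^sub>1\<close>, the constant \<open>R_const a\<close> is a times
  the integral over (0, 1) of \<open>s powr (a - 1)\<close> times the square of 1 + a / 2 * (1 - s);
  \<open>R_star a\<close> is a times the same integral over (0, 1 + 2 / a), up to the zero of the
  affine function. The main obstacle is the convexity of \<open>G\<close>. Log-concavity passes to
  products directly, whereas a product of positive convex functions need not be convex; it is when
  all of them decrease, which is why monotonicity is part of the notion below. Convexity is kept
  apart from it, because the endpoint power may be concave. Log-concavity is expressed by products
  at midpoints, a form that survives the limits defining infinite products. Strictness does not
  survive them and has to be drawn from factors split off beforehand.\<close>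

definition decr_logconcave_on :: "real set \<Rightarrow> (real \<Rightarrow> real) \<Rightarrow> bool" where
  "decr_logconcave_on X f \<longleftrightarrow>
     (\<forall>u\<in>X. 0 < f u) \<and> antimono_on X f \<and>
     (\<forall>u\<in>X. \<forall>v\<in>X. f u * f v \<le> (f ((u + v) / 2))\<^sup>2)"

lemma decr_logconcave_onI:
  assumes "\<And>u. u \<in> X \<Longrightarrow> 0 < f u"
    and "\<And>u v. \<lbrakk>u \<in> X; v \<in> X; u \<le> v\<rbrakk> \<Longrightarrow> f v \<le> f u"
    and "\<And>u v. \<lbrakk>u \<in> X; v \<in> X\<rbrakk> \<Longrightarrow> f u * f v \<le> (f ((u + v) / 2))\<^sup>2"
  shows "decr_logconcave_on X f"
  using assms unfolding decr_logconcave_on_def by (auto intro!: monotone_onI)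

lemma decr_logconcave_onD:
  assumes "decr_logconcave_on X f" "u \<in> X"
  shows "0 < f u"
    and "v \<in> X \<Longrightarrow> u \<le> v \<Longrightarrow> f v \<le> f u"
    and "v \<in> X \<Longrightarrow> f u * f v \<le> (f ((u + v) / 2))\<^sup>2"
  using assms unfolding decr_logconcave_on_def by (auto dest: monotone_onD)

lemma decr_logconcave_on_subset:
  "decr_logconcave_on X f \<Longrightarrow> Y \<subseteq> X \<Longrightarrow> decr_logconcave_on Y f"
  unfolding decr_logconcave_on_def by (meson monotone_on_subset subsetD)

lemma decr_logconcave_on_mult:
  assumes f: "decr_logconcave_on X f" and g: "decr_logconcave_on X g"
  shows "decr_logconcave_on X (\<lambda>u. f u * g u)"
proof (rule decr_logconcave_onI)
  note F = decr_logconcave_onD[OF f] and G = decr_logconcave_onD[OF g]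
  show "0 < f u * g u" if "u \<in> X" for u
    using F(1) G(1) that by simp
  show "f v * g v \<le> f u * g u" if "u \<in> X" "v \<in> X" "u \<le> v" for u v
    using F(2)[of u v] G(2)[of u v] F(1)[of u] G(1)[of v] that
    by (intro mult_mono) auto
  show "f u * g u * (f v * g v) \<le> (f ((u + v) / 2) * g ((u + v) / 2))\<^sup>2"
    if "u \<in> X" "v \<in> X" for u v
  proof -
    have "(f u * f v) * (g u * g v) \<le> (f ((u + v) / 2))\<^sup>2 * (g ((u + v) / 2))\<^sup>2"
      using F(1,3) G(1,3) that by (intro mult_mono) (auto intro: less_imp_le)
    then show ?thesis
      by (simp add: power_mult_distrib mult_ac)
  qed
qed

lemma decr_logconcave_on_const: "0 < c \<Longrightarrow> decr_logconcave_on X (\<lambda>_. c)"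
  by (rule decr_logconcave_onI) (auto simp: power2_eq_square)

lemma decr_logconcave_on_prod:
  assumes "\<And>i. i \<in> I \<Longrightarrow> decr_logconcave_on X (f i)"
  shows "decr_logconcave_on X (\<lambda>u. \<Prod>i\<in>I. f i u)"
  using assms
  by (induction I rule: infinite_finite_induct)
     (auto intro: decr_logconcave_on_mult decr_logconcave_on_const)

lemma decr_logconcave_on_linear_factor:
  assumes "0 < z"
  shows "decr_logconcave_on {..<z} (\<lambda>u. 1 - u / z)"
proof (rule decr_logconcave_onI)
  show "(1 - u / z) * (1 - v / z) \<le> (1 - (u + v) / 2 / z)\<^sup>2" for u v :: real
  proof -
    have "(1 - (u + v) / 2 / z)\<^sup>2 - (1 - u / z) * (1 - v / z) = ((u / z - v / z) / 2)\<^sup>2"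
      using assms by (simp add: power2_eq_square field_simps)
    then show ?thesis
      by (smt (verit) zero_le_power2)
  qed
qed (use assms in \<open>auto simp: divide_right_mono\<close>)

lemma decr_logconcave_on_exp:
  "0 \<le> l \<Longrightarrow> decr_logconcave_on X (\<lambda>u. exp (- l * u / 2))"
  by (rule decr_logconcave_onI)
     (auto simp: mult_left_mono power2_eq_square simp flip: exp_add, simp_all add: field_simps)

lemma decr_logconcave_on_powr:
  assumes "0 \<le> \<beta>"
  shows "decr_logconcave_on {..<B} (\<lambda>u. (B - u) powr \<beta>)"
proof (rule decr_logconcave_onI)
  fix u v assume uv: "u \<in> {..<B}" "v \<in> {..<B}"
  have "(B - u) * (B - v) \<le> (B - (u + v) / 2)\<^sup>2"
  proof -
    have "(B - (u + v) / 2)\<^sup>2 - (B - u) * (B - v) = ((u - v) / 2)\<^sup>2"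
      by (simp add: power2_eq_square field_simps)
    then show ?thesis
      by (smt (verit) zero_le_power2)
  qed
  then have "((B - u) * (B - v)) powr \<beta> \<le> ((B - (u + v) / 2)\<^sup>2) powr \<beta>"
    using uv assms by (intro powr_mono2) auto
  then show "(B - u) powr \<beta> * (B - v) powr \<beta> \<le> ((B - (u + v) / 2) powr \<beta>)\<^sup>2"
    using uv by (simp add: powr_mult power2_eq_square)
qed (use assms in \<open>auto intro: powr_mono2\<close>)

section \<open>Products of convex decreasing functions\<close>

text \<open>The chord of the product exceeds the product of the two chords by
  \<open>t * (1 - t) * ((f x - f y) * (g x - g y))\<close>, which is nonnegative because both
  factors decrease.\<close>

lemma convex_on_mult_decr_logconcave:
  assumes f: "decr_logconcave_on X f" "convex_on X f"
    and g: "decr_logconcave_on X g" "convex_on X g"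
  shows "convex_on X (\<lambda>u. f u * g u)"
proof (rule convex_onI)
  show "convex X" using f(2) by (rule convex_on_imp_convex)
  fix t x y :: real assume t: "0 < t" "t < 1" and xy: "x \<in> X" "y \<in> X"
  let ?m = "(1 - t) *\<^sub>R x + t *\<^sub>R y"
  have m: "?m \<in> X" using \<open>convex X\<close> t xy by (auto simp: convex_def)
  have "f ?m * g ?m \<le> ((1 - t) * f x + t * f y) * ((1 - t) * g x + t * g y)"
    using convex_onD[OF f(2), of t x y] convex_onD[OF g(2), of t x y] t xy m
      decr_logconcave_onD(1)[OF f(1), of ?m] decr_logconcave_onD(1)[OF g(1), of ?m]
    by (intro mult_mono) auto
  also have "\<dots> = (1 - t) * (f x * g x) + t * (f y * g y)
      - t * (1 - t) * ((f x - f y) * (g x - g y))"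
    by (simp add: algebra_simps)
  also have "0 \<le> (f x - f y) * (g x - g y)"
    using decr_logconcave_onD(2)[OF f(1), of x y] decr_logconcave_onD(2)[OF g(1), of x y]
      decr_logconcave_onD(2)[OF f(1), of y x] decr_logconcave_onD(2)[OF g(1), of y x] xy
    by (cases "x \<le> y") (auto intro: mult_nonneg_nonneg mult_nonpos_nonpos)
  then have "(1 - t) * (f x * g x) + t * (f y * g y) - t * (1 - t) * ((f x - f y) * (g x - g y))
      \<le> (1 - t) * (f x * g x) + t * (f y * g y)"
    using t by simp
  finally show "f ?m * g ?m \<le> (1 - t) * (f x * g x) + t * (f y * g y)" .
qed

lemma convex_on_prod_decr_logconcave:
  assumes "\<And>i. i \<in> I \<Longrightarrow> decr_logconcave_on X (f i) \<and> convex_on X (f i)" "convex X"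
  shows "convex_on X (\<lambda>u. \<Prod>i\<in>I. f i u)"
  using assms(1)
proof (induction I rule: infinite_finite_induct)
  case (insert i I)
  then show ?case
    using convex_on_mult_decr_logconcave[of X "f i" "\<lambda>u. \<Prod>i\<in>I. f i u"]
      decr_logconcave_on_prod[of I X f] by simp
qed (simp_all add: convex_on_const assms(2))

lemma convex_on_linear_factor: "convex X \<Longrightarrow> convex_on X (\<lambda>u::real. 1 - u / z)"
  by (rule convex_onI) (auto simp: algebra_simps add_divide_distrib diff_divide_distrib)

lemma convex_on_exp_linear: "convex X \<Longrightarrow> convex_on X (\<lambda>u. exp (- l * u / 2))"
  by (rule f''_ge0_imp_convex[where f' = "\<lambda>u. - l / 2 * exp (- l * u / 2)"
        and f'' = "\<lambda>u. (l / 2)\<^sup>2 * exp (- l * u / 2)"])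
     (auto intro!: derivative_eq_intros simp: power2_eq_square)

section \<open>Strict midpoint convexity\<close>

text \<open>Midpoints suffice, because the strict tangent bound needs only one strict inequality, at
  the midpoint of a point and the peak.\<close>

definition strictly_midconvex_on :: "real set \<Rightarrow> (real \<Rightarrow> real) \<Rightarrow> bool" where
  "strictly_midconvex_on X f \<longleftrightarrow>
     (\<forall>u\<in>X. \<forall>v\<in>X. u < v \<longrightarrow> f ((u + v) / 2) < (f u + f v) / 2)"

lemma convex_on_midpoint:
  assumes "convex_on X f" "u \<in> X" "(v::real) \<in> X"
  shows "f ((u + v) / 2) \<le> (f u + f v) / 2"
  using convex_onD[OF assms(1), of "1/2" u v] assms(2,3)
  by (simp add: field_simps)

lemma midpoint_mem: "convex X \<Longrightarrow> u \<in> X \<Longrightarrow> v \<in> X \<Longrightarrow> (u + v) / 2 \<in> X" for u v :: real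
  using convexD[of X u v "1/2" "1/2"] by (simp add: field_simps)

lemma strictly_midconvex_on_mult_convex:
  assumes f: "decr_logconcave_on X f" "convex_on X f" "strictly_midconvex_on X f"
    and g: "decr_logconcave_on X g" "convex_on X g"
  shows "strictly_midconvex_on X (\<lambda>u. f u * g u)"
  unfolding strictly_midconvex_on_def
proof (intro ballI impI)
  fix u v assume uv: "u \<in> X" "v \<in> X" "u < v"
  let ?m = "(u + v) / 2"
  have m: "?m \<in> X" using midpoint_mem convex_on_imp_convex f(2) uv by blast
  have "f ?m * g ?m < (f u + f v) / 2 * g ?m"
    using f(3) uv decr_logconcave_onD(1)[OF g(1) m]
    by (simp add: strictly_midconvex_on_def)
  also have "\<dots> \<le> (f u + f v) / 2 * ((g u + g v) / 2)"
    using convex_on_midpoint[OF g(2)] uv decr_logconcave_onD(1)[OF f(1)]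
    by (intro mult_left_mono) (auto simp: less_imp_le intro!: add_nonneg_nonneg)
  also have "\<dots> = (f u * g u + f v * g v) / 2 - (f u - f v) * (g u - g v) / 4"
    by (simp add: field_simps)
  also have "\<dots> \<le> (f u * g u + f v * g v) / 2"
    using mult_nonneg_nonneg[of "f u - f v" "g u - g v"] decr_logconcave_onD(2)[OF f(1), of u v]
      decr_logconcave_onD(2)[OF g(1), of u v] uv by argo
  finally show "f ?m * g ?m < (f u * g u + f v * g v) / 2" .
qed

text \<open>Covers factors that may both be affine: strictness comes from the cross term
  \<open>(f u - f v) * (g u - g v)\<close>, positive because both factors decrease strictly.\<close>

lemma strictly_midconvex_on_mult_decreasing:
  assumes f: "decr_logconcave_on X f" "convex_on X f" "strict_antimono_on X f"
    and g: "decr_logconcave_on X g" "convex_on X g" "strict_antimono_on X g"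
  shows "strictly_midconvex_on X (\<lambda>u. f u * g u)"
  unfolding strictly_midconvex_on_def
proof (intro ballI impI)
  fix u v assume uv: "u \<in> X" "v \<in> X" "u < v"
  let ?m = "(u + v) / 2"
  have m: "?m \<in> X" using midpoint_mem convex_on_imp_convex f(2) uv by blast
  have "f ?m * g ?m \<le> (f u + f v) / 2 * ((g u + g v) / 2)"
    using convex_on_midpoint[OF f(2)] convex_on_midpoint[OF g(2)] uv
      decr_logconcave_onD(1)[OF f(1)] decr_logconcave_onD(1)[OF g(1)] m
    by (intro mult_mono) (auto simp: less_imp_le intro!: add_nonneg_nonneg)
  also have "\<dots> = (f u * g u + f v * g v) / 2 - (f u - f v) * (g u - g v) / 4"
    by (simp add: field_simps)
  also have "\<dots> < (f u * g u + f v * g v) / 2"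
    using mult_pos_pos[of "f u - f v" "g u - g v"] monotone_onD[OF f(3), of u v]
      monotone_onD[OF g(3), of u v] uv by argo
  finally show "f ?m * g ?m < (f u * g u + f v * g v) / 2" .
qed

lemma strictly_midconvex_on_exp:
  assumes "0 < l"
  shows "strictly_midconvex_on X (\<lambda>u. exp (- l * u / 2))"
  unfolding strictly_midconvex_on_def
proof (intro ballI impI)
  fix u v :: real assume "u < v"
  then have "exp (- l * u / 4) \<noteq> exp (- l * v / 4)" using assms by simp
  then have "0 < (exp (- l * u / 4) - exp (- l * v / 4))\<^sup>2" by simp
  also have "\<dots> = exp (- l * u / 2) + exp (- l * v / 2) - 2 * exp (- l * ((u + v) / 2) / 2)"
    by (simp add: power2_eq_square algebra_simps flip: exp_add) (simp add: field_simps)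
  finally show "exp (- l * ((u + v) / 2) / 2) < (exp (- l * u / 2) + exp (- l * v / 2)) / 2"
    by simp
qed

lemma strictly_midconvex_on_derivI:
  assumes "convex X"
    and f': "\<And>x. x \<in> X \<Longrightarrow> (f has_real_derivative f' x) (at x)"
    and f'': "\<And>x. x \<in> X \<Longrightarrow> (f' has_real_derivative f'' x) (at x)"
    and pos: "\<And>x. x \<in> X \<Longrightarrow> 0 < f'' x"
  shows "strictly_midconvex_on X f"
  unfolding strictly_midconvex_on_def
proof (intro ballI impI)
  fix u v :: real assume uv: "u \<in> X" "v \<in> X" "u < v"
  let ?m = "(u + v) / 2"
  have X: "x \<in> X" if "u \<le> x" "x \<le> v" for x
    using closed_segment_subset[OF uv(1,2) assms(1)] that uv(3)
    by (auto simp: closed_segment_eq_real_ivl)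
  obtain x where x: "u < x" "x < ?m" "f ?m - f u = (?m - u) * f' x"
    using MVT2[of u ?m f f'] f' X uv by force
  obtain y where y: "?m < y" "y < v" "f v - f ?m = (v - ?m) * f' y"
    using MVT2[of ?m v f f'] f' X uv by force
  have "f' x < f' y"
    using x y X f'' pos by (intro DERIV_pos_imp_increasing[of x y f']) (force, meson X less_imp_le order_trans)
  then have "(?m - u) * f' x < (?m - u) * f' y" using uv(3) by simp
  moreover have "v - ?m = ?m - u" by (simp add: field_simps)
  ultimately show "f ?m < (f u + f v) / 2" using x(3) y(3) by argo
qed

text \<open>
  For \<open>0 < \<beta> < 1\<close> the factor \<open>(B - u) powr \<beta>\<close> is concave; the linear factor vanishing at \<open>z < B\<close>
  compensates for this.
\<close>
lemma
  fixes z B \<beta> :: real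
  assumes "0 < z" "z < B" "0 \<le> \<beta>"
  shows convex_on_linear_powr: "convex_on {..<z} (\<lambda>u. (1 - u / z) * (B - u) powr \<beta>)"
    and strictly_midconvex_on_linear_powr:
      "0 < \<beta> \<Longrightarrow> strictly_midconvex_on {..<z} (\<lambda>u. (1 - u / z) * (B - u) powr \<beta>)"
proof -
  define f' where "f' = (\<lambda>u. - (1 / z) * (B - u) powr \<beta> - \<beta> * (1 - u / z) * (B - u) powr (\<beta> - 1))"
  define f'' where "f'' = (\<lambda>u. 2 * \<beta> / z * (B - u) powr (\<beta> - 1)
      + \<beta> * (\<beta> - 1) * (1 - u / z) * (B - u) powr (\<beta> - 2))"
  have d1: "((\<lambda>u. (1 - u / z) * (B - u) powr \<beta>) has_real_derivative f' u) (at u)"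
    if "u \<in> {..<z}" for u
    unfolding f'_def using that assms
    by (auto intro!: derivative_eq_intros simp: field_simps)
  have d2: "(f' has_real_derivative f'' u) (at u)" if "u \<in> {..<z}" for u
    unfolding f'_def f''_def using that assms
    by (auto intro!: derivative_eq_intros simp: field_simps)
  \<comment> \<open>As z - u \<le> B - u, the first term of \<open>f''\<close> outweighs the second,
    which is negative for \<beta> < 1; what remains is 2 * \<beta> + \<beta> * (\<beta> - 1) =
    \<beta> * (\<beta> + 1).\<close>
  have lower: "\<beta> * (\<beta> + 1) * ((z - u) / z) * (B - u) powr (\<beta> - 2) \<le> f'' u"
    if "u \<in> {..<z}" for u
  proof -
    have p: "(B - u) powr (\<beta> - 1) = (B - u) * (B - u) powr (\<beta> - 2)"
      using that assms powr_mult_base[of "B - u" "\<beta> - 2"] by simp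
    have "f'' u = (2 * \<beta> * ((B - u) / z) + \<beta> * (\<beta> - 1) * ((z - u) / z)) * (B - u) powr (\<beta> - 2)"
      unfolding f''_def p using assms by (simp add: field_simps)
    moreover have "\<beta> * ((z - u) / z) \<le> \<beta> * ((B - u) / z)"
      using assms by (intro mult_left_mono divide_right_mono) auto
    then have "\<beta> * (\<beta> + 1) * ((z - u) / z) \<le> 2 * \<beta> * ((B - u) / z) + \<beta> * (\<beta> - 1) * ((z - u) / z)"
      by argo
    ultimately show ?thesis by (simp only: mult_right_mono powr_ge_zero)
  qed
  have "0 \<le> f'' u" if "u \<in> {..<z}" for u
    by (rule order_trans[OF _ lower[OF that]]) (use that assms in auto)
  then show "convex_on {..<z} (\<lambda>u. (1 - u / z) * (B - u) powr \<beta>)"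
    using d1 d2 by (intro f''_ge0_imp_convex) auto
  assume "0 < \<beta>"
  then have "0 < f'' u" if "u \<in> {..<z}" for u
    by (intro less_le_trans[OF _ lower[OF that]]) (use that assms in auto)
  then show "strictly_midconvex_on {..<z} (\<lambda>u. (1 - u / z) * (B - u) powr \<beta>)"
    using d1 d2 by (intro strictly_midconvex_on_derivI) auto
qed

section \<open>Pointwise limits\<close>

lemma decr_logconcave_on_LIMSEQ:
  assumes f: "\<And>n. decr_logconcave_on X (f n)" "convex X"
    and lim: "\<And>u. u \<in> X \<Longrightarrow> (\<lambda>n. f n u) \<longlonglongrightarrow> F u"
    and pos: "\<And>u. u \<in> X \<Longrightarrow> 0 < F u"
  shows "decr_logconcave_on X F"
proof (rule decr_logconcave_onI)
  show "F v \<le> F u" if "u \<in> X" "v \<in> X" "u \<le> v" for u v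
    using lim that decr_logconcave_onD(2)[OF f(1)] by (meson LIMSEQ_le)
  show "F u * F v \<le> (F ((u + v) / 2))\<^sup>2" if "u \<in> X" "v \<in> X" for u v
  proof (rule LIMSEQ_le)
    show "(\<lambda>n. f n u * f n v) \<longlonglongrightarrow> F u * F v"
      using lim that by (intro tendsto_mult)
    show "(\<lambda>n. (f n ((u + v) / 2))\<^sup>2) \<longlonglongrightarrow> (F ((u + v) / 2))\<^sup>2"
      by (intro tendsto_power lim midpoint_mem[OF f(2)] that)
  qed (use decr_logconcave_onD(3)[OF f(1)] that in blast)
qed (rule pos)

lemma convex_on_LIMSEQ:
  assumes f: "\<And>n. convex_on X (f n)"
    and lim: "\<And>u. u \<in> X \<Longrightarrow> (\<lambda>n. f n u) \<longlonglongrightarrow> F u"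
  shows "convex_on X F"
proof (rule convex_onI)
  show "convex X" using f convex_on_imp_convex by blast
  fix t :: real and x y assume t: "0 < t" "t < 1" and xy: "x \<in> X" "y \<in> X"
  show "F ((1 - t) *\<^sub>R x + t *\<^sub>R y) \<le> (1 - t) * F x + t * F y"
  proof (rule LIMSEQ_le)
    show "(\<lambda>n. f n ((1 - t) *\<^sub>R x + t *\<^sub>R y)) \<longlonglongrightarrow> F ((1 - t) *\<^sub>R x + t *\<^sub>R y)"
      using \<open>convex X\<close> t xy by (intro lim) (auto simp: convex_def)
    show "(\<lambda>n. (1 - t) * f n x + t * f n y) \<longlonglongrightarrow> (1 - t) * F x + t * F y"
      using lim xy by (intro tendsto_intros)
  qed (use convex_onD[OF f] t xy in auto)
qed

section \<open>Integrals of powers times squared affine functions\<close>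

text \<open>The integrand may be unbounded at 0 when a < 1, so the fundamental theorem is applied on
  the open interval, with one-sided limits of the antiderivative \<open>Q\<close>. The real-valued
  integral serves (M), the \<open>ennreal\<close> one serves (P), whose moment may be
  infinite.\<close>

lemma
  fixes a \<alpha> \<gamma> x :: real
  assumes "0 < a" "0 < x"
  defines "Q \<equiv> \<lambda>u. \<alpha>\<^sup>2 * u powr a / a - 2 * \<alpha> * \<gamma> * u powr (a + 1) / (a + 1)
      + \<gamma>\<^sup>2 * u powr (a + 2) / (a + 2)"
  shows set_integrable_powr_linear_squared:
      "set_integrable lborel {0<..<x} (\<lambda>u. u powr (a - 1) * (\<alpha> - \<gamma> * u)\<^sup>2)"
    and set_integral_powr_linear_squared:
      "(LBINT u:{0<..<x}. u powr (a - 1) * (\<alpha> - \<gamma> * u)\<^sup>2) = Q x"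
    and nn_integral_powr_linear_squared:
      "(\<integral>\<^sup>+u\<in>{0<..<x}. ennreal (u powr (a - 1) * (\<alpha> - \<gamma> * u)\<^sup>2) \<partial>lborel) = ennreal (Q x)"
proof -
  let ?f = "\<lambda>u. u powr (a - 1) * (\<alpha> - \<gamma> * u)\<^sup>2"
  have der: "(Q has_real_derivative ?f u) (at u)" if "0 < u" for u
  proof -
    have p: "u powr (a + 1 - 1) = u * u powr (a - 1)" "u powr (a + 2 - 1) = u * u * u powr (a - 1)"
      using that powr_mult_base[of u "a - 1"] powr_mult_base[of u a]
      by (simp_all add: add.commute mult.assoc)
    have "(Q has_real_derivative (\<alpha>\<^sup>2 * u powr (a - 1) - 2 * \<alpha> * \<gamma> * u powr (a + 1 - 1)
        + \<gamma>\<^sup>2 * u powr (a + 2 - 1))) (at u)"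
      unfolding Q_def using that assms(1)
      by (auto intro!: derivative_eq_intros)
    then show ?thesis
      unfolding p by (simp add: power2_eq_square algebra_simps)
  qed
  have contQ: "continuous_on {0..} Q"
    unfolding Q_def using assms(1) by (intro continuous_on_powr' continuous_intros) auto
  have e: "einterval (ereal 0) (ereal x) = {0<..<x}" by (auto simp: einterval_iff)
  have A: "((Q \<circ> real_of_ereal) \<longlongrightarrow> Q 0) (at_right (ereal 0))"
  proof -
    have "(Q \<longlongrightarrow> Q 0) (at_right 0)"
      using contQ by (auto simp: continuous_on_def intro: tendsto_within_subset)
    then show ?thesis by (simp add: ereal_tendsto_simps)
  qed
  have B: "((Q \<circ> real_of_ereal) \<longlongrightarrow> Q x) (at_left (ereal x))"
  proof -
    have "isCont Q x" using der[OF assms(2)] by (rule DERIV_isCont)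
    then have "(Q \<longlongrightarrow> Q x) (at_left x)"
      by (simp add: isCont_def filterlim_at_split)
    then show ?thesis by (simp add: ereal_tendsto_simps)
  qed
  have "set_integrable lborel (einterval (ereal 0) (ereal x)) ?f \<and>
        (LBINT u=ereal 0..ereal x. ?f u) = Q x - Q 0"
    by (rule conjI; rule interval_integral_FTC_nonneg[OF _ der _ _ A B])
       (use assms in \<open>auto intro!: continuous_intros simp: zero_ereal_def\<close>)
  then have int: "set_integrable lborel {0<..<x} ?f" and eq: "(LBINT u=ereal 0..ereal x. ?f u) = Q x - Q 0"
    unfolding e by auto
  have Q0: "Q 0 = 0" by (simp add: Q_def)
  show "set_integrable lborel {0<..<x} ?f" by fact
  show val: "(LBINT u:{0<..<x}. ?f u) = Q x"
    using eq assms(2) unfolding Q0 interval_lebesgue_integral_def e by simp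
  have "(\<integral>\<^sup>+u\<in>{0<..<x}. ennreal (?f u) \<partial>lborel) = (\<integral>\<^sup>+u. ennreal (indicator {0<..<x} u *\<^sub>R ?f u) \<partial>lborel)"
    by (intro nn_integral_cong) (auto split: split_indicator)
  also have "\<dots> = ennreal (LBINT u. indicator {0<..<x} u *\<^sub>R ?f u)"
    using int unfolding set_integrable_def by (intro nn_integral_eq_integral) auto
  finally show "(\<integral>\<^sup>+u\<in>{0<..<x}. ennreal (?f u) \<partial>lborel) = ennreal (Q x)"
    using val by (simp add: set_lebesgue_integral_def)
qed

section \<open>The first lobe\<close>

lemma powr_half_squared: "(u powr (a / 2))\<^sup>2 = u powr a" for u a :: real
  using powr_add[of u "a / 2" "a / 2"] by (simp add: power2_eq_square)

text \<open>The domain is the whole ray below \<open>Z\<close>, negative arguments included, so that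
  0 is an interior point and continuity there follows from convexity. The chord bound
  \<open>upper\<close> makes \<open>F\<close> small near a finite first zero and keeps the zero of
  the tangent from passing it; \<open>decay\<close> controls \<open>F\<close> at infinity when there
  is no zero. The value in \<open>zero\<close> matters at the last point t = 1 + 2 / a of
  (E).\<close>

locale lobe =
  fixes a :: real and Z :: ereal and G :: "real \<Rightarrow> real"
  assumes a_pos: "0 < a"
    and Z_pos: "0 < Z"
    and decr_logconcave: "decr_logconcave_on {u. ereal u < Z} G"
    and convex: "convex_on {u. ereal u < Z} G"
    and zero: "Z = ereal z \<Longrightarrow> G z = 0"
    and upper: "Z = ereal z \<Longrightarrow> 0 \<le> u \<Longrightarrow> u < z \<Longrightarrow> G u \<le> G 0 * (1 - u / z)"
    and decay: "Z = \<infinity> \<Longrightarrow> \<exists>c>0. \<forall>u\<ge>c. u powr (a / 2) * G u \<le> c powr (a / 2) * G c"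
begin

definition F :: "real \<Rightarrow> real" where
  "F u = u powr (a / 2) * G u"

definition peak :: real where
  "peak = (THE u. is_arg_max F (\<lambda>v. 0 < v \<and> ereal v < Z) u)"

lemma G_pos: "ereal u < Z \<Longrightarrow> 0 < G u"
  using decr_logconcave_onD(1)[OF decr_logconcave] by simp

lemma G_antimono: "ereal v < Z \<Longrightarrow> u \<le> v \<Longrightarrow> G v \<le> G u"
  using decr_logconcave_onD(2)[OF decr_logconcave, of u v] by (cases Z) auto

lemma continuous_on_G: "continuous_on {u. ereal u < Z} G"
proof (rule convex_on_continuous[OF _ convex])
  show "open {u. ereal u < Z}" by (cases Z) (auto simp flip: lessThan_def)
qed

lemma continuous_on_F: "continuous_on {u. 0 \<le> u \<and> ereal u < Z} F"
  unfolding F_def using a_pos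
  by (intro continuous_on_powr' continuous_intros continuous_on_subset[OF continuous_on_G]) auto

lemma F_pos: "0 < u \<Longrightarrow> ereal u < Z \<Longrightarrow> 0 < F u"
  unfolding F_def using G_pos by simp

section \<open>Existence and uniqueness of the maximum\<close>

text \<open>Confines the search for a maximum to the compact interval \<open>{0..c}\<close>, which
  also contains the comparison point \<open>x\<close>.\<close>

lemma F_eventually_dominated:
  "\<exists>x c. 0 < x \<and> x \<le> c \<and> ereal c < Z \<and> (\<forall>u. c < u \<longrightarrow> ereal u < Z \<longrightarrow> F u \<le> F x)"
proof (cases Z)
  case PInf
  then show ?thesis using decay unfolding F_def by (meson less_ereal.simps(4) less_imp_le order_refl)
next
  case (real z)
  then have z: "0 < z" using Z_pos by simp
  define x where "x = z / 2"
  have x: "0 < x" "x < z" "0 < F x" using z real F_pos by (auto simp: x_def)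
  \<comment> \<open>By \<open>upper\<close>, \<open>F u\<close> is at most this expression, and its
    limit at \<open>z\<close> is 0.\<close>
  have "((\<lambda>u. z powr (a / 2) * (G 0 * (1 - u / z))) \<longlongrightarrow> z powr (a / 2) * (G 0 * (1 - z / z))) (at_left z)"
    using z by (intro tendsto_intros) auto
  then have "\<forall>\<^sub>F u in at_left z. z powr (a / 2) * (G 0 * (1 - u / z)) < F x"
    using z x(3) by (intro order_tendstoD) auto
  then obtain c where c: "c < z" "\<And>u. c < u \<Longrightarrow> u < z \<Longrightarrow> z powr (a / 2) * (G 0 * (1 - u / z)) < F x"
    unfolding eventually_at_left_field by auto
  have "F u \<le> F x" if "max x c < u" "u < z" for u
  proof -
    have "F u \<le> z powr (a / 2) * (G 0 * (1 - u / z))"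
      unfolding F_def using upper[OF real, of u] that x a_pos G_pos[of u] real
      by (intro mult_mono powr_mono2) auto
    then show ?thesis using c(2)[of u] that by simp
  qed
  then show ?thesis using x c real by (intro exI[of _ x] exI[of _ "max x c"]) auto
qed (use Z_pos in auto)

lemma ex_arg_max: "\<exists>u. is_arg_max F (\<lambda>v. 0 < v \<and> ereal v < Z) u"
proof -
  obtain x c where x: "0 < x" "x \<le> c" "ereal c < Z"
    and c: "\<And>u. c < u \<Longrightarrow> ereal u < Z \<Longrightarrow> F u \<le> F x"
    using F_eventually_dominated by blast
  have "continuous_on {0..c} F"
    using continuous_on_F by (rule continuous_on_subset) (use x(3) in \<open>auto intro: le_less_trans[of "ereal _" "ereal c"]\<close>)
  then obtain m where m: "m \<in> {0..c}" "\<And>u. u \<in> {0..c} \<Longrightarrow> F u \<le> F m"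
    using continuous_attains_sup[of "{0..c}" F] x by auto
  have xZ: "ereal x < Z" using x by (meson ereal_less_eq(3) le_less_trans)
  have "0 < F m" using m(2)[of x] F_pos[OF x(1) xZ] x by simp
  then have "m \<noteq> 0" unfolding F_def by auto
  moreover have "ereal m < Z" using m(1) x(3) by (meson atLeastAtMost_iff ereal_less_eq(3) le_less_trans)
  moreover have "F u \<le> F m" if "0 < u" "ereal u < Z" for u
    using m(2)[of u] m(2)[of x] c[of u] that x by (cases "u \<le> c") auto
  ultimately show ?thesis
    using m(1) unfolding is_arg_max_linorder by (intro exI[of _ m]) auto
qed

text \<open>Uniqueness: \<open>G\<close> is log-concave and \<open>u powr (a / 2)\<close> is strictly log-concave.\<close>
lemma arg_max_unique:
  assumes "is_arg_max F (\<lambda>v. 0 < v \<and> ereal v < Z) u" "is_arg_max F (\<lambda>v. 0 < v \<and> ereal v < Z) v"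
  shows "u = v"
proof (rule ccontr)
  assume ne: "u \<noteq> v"
  let ?m = "(u + v) / 2"
  have u: "0 < u" "ereal u < Z" and v: "0 < v" "ereal v < Z"
    and m: "0 < ?m" "ereal ?m < Z"
    using assms unfolding is_arg_max_linorder by (cases Z; auto)+
  have eq: "F v = F u" "F ?m \<le> F u"
    using assms m unfolding is_arg_max_linorder by (auto intro: antisym)
  have "0 < (u - v)\<^sup>2" using ne by simp
  then have "u * v < ?m\<^sup>2" by (simp add: power2_eq_square field_simps)
  then have "(u * v) powr (a / 2) < (?m\<^sup>2) powr (a / 2)"
    using u v a_pos by (intro powr_less_mono2) auto
  then have p: "u powr (a / 2) * v powr (a / 2) < (?m powr (a / 2))\<^sup>2"
    using u v m by (simp only: powr_mult power2_eq_square less_imp_le)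
  have "F u * F v = (u powr (a / 2) * v powr (a / 2)) * (G u * G v)"
    by (simp add: F_def mult_ac)
  also have "\<dots> < (?m powr (a / 2))\<^sup>2 * (G u * G v)"
    using p G_pos u v by simp
  also have "\<dots> \<le> (?m powr (a / 2))\<^sup>2 * (G ?m)\<^sup>2"
    using decr_logconcave_onD(3)[OF decr_logconcave, of u v] u v by (intro mult_left_mono) auto
  also have "\<dots> = F ?m * F ?m" by (simp add: F_def power2_eq_square mult_ac)
  also have "\<dots> \<le> F u * F u" using eq(2) F_pos[OF m] by (intro mult_mono) auto
  finally show False using eq(1) by simp
qed

lemma is_arg_max_peak: "is_arg_max F (\<lambda>v. 0 < v \<and> ereal v < Z) peak"
proof -
  obtain u where u: "is_arg_max F (\<lambda>v. 0 < v \<and> ereal v < Z) u" using ex_arg_max by blast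
  show ?thesis unfolding peak_def
    by (rule theI[of "is_arg_max F (\<lambda>v. 0 < v \<and> ereal v < Z)", OF u]) (rule arg_max_unique[OF _ u])
qed

lemma peak_pos: "0 < peak" and peak_less: "ereal peak < Z"
  and F_le_peak: "0 < u \<Longrightarrow> ereal u < Z \<Longrightarrow> F u \<le> F peak"
  using is_arg_max_peak unfolding is_arg_max_linorder by auto

lemma F_peak_pos: "0 < F peak"
  using F_pos peak_pos peak_less by blast

section \<open>The tangent at the peak\<close>

definition tangent :: "real \<Rightarrow> real" where
  "tangent u = G peak * (1 + a / 2 * (1 - u / peak))"

text \<open>
  \<open>G\<close> lies below \<open>h v = F peak * v powr (- a / 2)\<close>, with equality at the peak, so the slope of the
  supporting line of the convex function \<open>G\<close> at the peak is \<open>h' peak\<close>.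
\<close>
lemma tangent_le:
  assumes u: "ereal u < Z"
  shows "tangent u \<le> G u"
proof -
  define p where "p = peak"
  \<comment> \<open>\<open>\<phi>\<close> follows the majorant from the peak away from
    \<open>u\<close>. The peak then lies between \<open>p + t * (p - u)\<close> and
    \<open>u\<close>, so convexity bounds \<open>G p - G u\<close> by the difference quotient of
    \<open>\<phi>\<close>; letting t decrease to 0 needs no derivative of \<open>G\<close>.\<close>
  define \<phi> where "\<phi> = (\<lambda>t. F p * (p + t * (p - u)) powr (- a / 2))"
  define D where "D = F p * (- a / 2 * p powr (- a / 2 - 1) * (p - u))"
  have p: "0 < p" "ereal p < Z" using peak_pos peak_less by (auto simp: p_def)
  have "(\<phi> has_real_derivative D) (at 0)"
    unfolding \<phi>_def D_def using p by (auto intro!: derivative_eq_intros)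
  then have "((\<lambda>t. (\<phi> t - \<phi> 0) / t) \<longlongrightarrow> D) (at 0)"
    by (simp add: has_field_derivative_iff)
  then have lim: "((\<lambda>t. (\<phi> t - \<phi> 0) / t) \<longlongrightarrow> D) (at_right 0)"
    by (rule filterlim_mono[OF _ order_refl]) (simp add: at_le)
  have \<phi>0: "\<phi> 0 = G p"
    using p by (simp add: \<phi>_def F_def powr_minus field_simps)
  have "D = F p * p powr (- a / 2) * (- a / 2 * (1 - u / p))"
    unfolding D_def powr_diff using p by (simp add: field_simps)
  then have D: "D = G p * (- a / 2 * (1 - u / p))"
    using \<phi>0 by (simp add: \<phi>_def)
  have "\<forall>\<^sub>F t in at_right 0. 0 < p + t * (p - u) \<and> ereal (p + t * (p - u)) < Z \<and> 0 < t"
  proof -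
    have t1: "((\<lambda>t. p + t * (p - u)) \<longlongrightarrow> p + 0 * (p - u)) (at_right 0)"
      by (intro tendsto_intros)
    then have "((\<lambda>t. ereal (p + t * (p - u))) \<longlongrightarrow> ereal p) (at_right 0)" by simp
    then have "\<forall>\<^sub>F t in at_right 0. ereal (p + t * (p - u)) < Z" using p(2) by (rule order_tendstoD)
    moreover have "\<forall>\<^sub>F t in at_right 0. 0 < p + t * (p - u)"
      using t1 by (rule order_tendstoD) (use p in simp)
    ultimately show ?thesis
      using eventually_at_right_less[of 0] by eventually_elim simp
  qed
  then have "\<forall>\<^sub>F t in at_right 0. G p - G u \<le> (\<phi> t - \<phi> 0) / t"
  proof eventually_elim
    case (elim t)
    let ?s = "p + t * (p - u)"
    have "F ?s \<le> F p" using F_le_peak elim by (simp add: p_def)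
    then have le: "G ?s \<le> \<phi> t"
      using elim unfolding \<phi>_def F_def[of ?s] by (simp add: powr_minus field_simps)
    have "(1 - t / (1 + t)) *\<^sub>R ?s + (t / (1 + t)) *\<^sub>R u = p"
      using elim by (simp add: divide_simps) (simp add: algebra_simps)
    then have "G p \<le> (1 - t / (1 + t)) * G ?s + t / (1 + t) * G u"
      using convex_onD[OF convex, of "t / (1 + t)" ?s u] elim u by simp
    also have "1 - t / (1 + t) = 1 / (1 + t)" using elim by (simp add: field_simps)
    finally have "G p \<le> (G ?s + t * G u) / (1 + t)"
      by (simp add: add_divide_distrib)
    then have "(1 + t) * G p \<le> G ?s + t * G u"
      using elim by (simp add: pos_le_divide_eq mult.commute)
    then have "t * (G p - G u) \<le> \<phi> t - \<phi> 0" using le \<phi>0 by (simp add: algebra_simps)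
    then show ?case using elim by (simp add: field_simps)
  qed
  then have "G p - G u \<le> D" using lim by (intro tendsto_lowerbound) auto
  then show ?thesis unfolding D tangent_def p_def[symmetric] by (simp add: algebra_simps)
qed

text \<open>The tangent stays below \<open>G\<close>, hence below the chord bound
  \<open>G 0 * (1 - u / z)\<close>. In the limit it is nonpositive at \<open>z\<close>, and as it
  decreases, its zero comes no later.\<close>

lemma tangent_zero_le: "ereal ((1 + 2 / a) * peak) \<le> Z"
proof (cases Z)
  case (real z)
  have z: "0 < z" using real Z_pos by simp
  have "tangent z \<le> G 0 * (1 - z / z)"
  proof (rule tendsto_le[of "at_left z"])
    show "((\<lambda>u. G 0 * (1 - u / z)) \<longlongrightarrow> G 0 * (1 - z / z)) (at_left z)"
      using z by (intro tendsto_intros) auto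
    show "(tangent \<longlongrightarrow> tangent z) (at_left z)"
      unfolding tangent_def[abs_def] using peak_pos by (intro tendsto_intros) auto
    have "\<forall>\<^sub>F u in at_left z. u \<in> {0<..<z}"
      using eventually_at_left_real[OF z] .
    then show "\<forall>\<^sub>F u in at_left z. tangent u \<le> G 0 * (1 - u / z)"
    proof eventually_elim
      case (elim u)
      then show ?case using tangent_le[of u] upper[OF real, of u] real by simp
    qed
  qed simp
  then have "1 + a / 2 * (1 - z / peak) \<le> 0"
    using z G_pos[OF peak_less] by (simp add: tangent_def mult_le_0_iff)
  then have "(1 + 2 / a) * peak \<le> z"
    using peak_pos a_pos by (simp add: field_simps)
  then show ?thesis using real by simp
qed (use Z_pos in auto)

lemma F_ratio_ge:
  assumes "t \<in> {0..1 + 2 / a}"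
  shows "t powr (a / 2) * (1 + a / 2 * (1 - t)) \<le> F (t * peak) / F peak"
proof -
  have le: "ereal (t * peak) \<le> ereal ((1 + 2 / a) * peak)"
    using assms peak_pos by simp
  have "tangent (t * peak) \<le> G (t * peak)"
  proof (cases "ereal (t * peak) < Z")
    case True
    then show ?thesis by (rule tangent_le)
  next
    \<comment> \<open>The point reaches \<open>Z\<close> only if t = 1 + 2 / a and the tangent
      vanishes exactly at the first zero of \<open>G\<close>; both sides are then 0.\<close>
    case False
    then have Z: "Z = ereal (t * peak)" using le tangent_zero_le by (meson antisym not_less order_trans)
    then have "t * peak = (1 + 2 / a) * peak" using le tangent_zero_le by (metis antisym ereal_less_eq(3))
    then have "t = 1 + 2 / a" using peak_pos by simp
    then have "tangent (t * peak) = 0"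
      using peak_pos a_pos unfolding tangent_def by (simp add: field_simps)
    then show ?thesis using zero[OF Z] by simp
  qed
  then have "(t * peak) powr (a / 2) * tangent (t * peak) \<le> F (t * peak)"
    unfolding F_def by (intro mult_left_mono) auto
  moreover have "(t * peak) powr (a / 2) * tangent (t * peak)
      = t powr (a / 2) * (1 + a / 2 * (1 - t)) * F peak"
    using assms peak_pos by (simp add: powr_mult F_def tangent_def)
  ultimately show ?thesis using F_peak_pos by (simp add: field_simps)
qed

text \<open>The midpoint of \<open>u\<close> and the peak satisfies the weak bound. As the tangent
  is affine and meets \<open>G\<close> at the peak, strict midpoint convexity turns this into a
  strict bound at \<open>u\<close>.\<close>

lemma tangent_less:
  assumes "strictly_midconvex_on {u. ereal u < Z} G" "u < peak"
  shows "tangent u < G u"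
proof -
  have u: "ereal u < Z" using assms(2) peak_less by (cases Z) auto
  have "tangent ((u + peak) / 2) \<le> G ((u + peak) / 2)"
    using assms(2) peak_less by (intro tangent_le) (cases Z; auto)
  also have "\<dots> < (G u + G peak) / 2"
    using assms u peak_less by (simp add: strictly_midconvex_on_def)
  finally show ?thesis unfolding tangent_def using peak_pos by (simp add: field_simps)
qed

text \<open>The difference of the tangent and an affine \<open>G\<close> is a multiple of
  \<open>u - peak\<close> and nonpositive on both sides of the peak, so the multiple is 0. The test
  points are 0 and some \<open>x\<close> between the peak and \<open>Z\<close>.\<close>

lemma tangent_eq:
  assumes affine: "\<And>u. ereal u < Z \<Longrightarrow> G u = c * (1 - u / z)" and u: "ereal u < Z"
  shows "tangent u = G u"
proof -
  have "\<forall>\<^sub>F x in at_right peak. ereal x < Z"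
    using order_tendstoD(2)[of "\<lambda>x. ereal x" "ereal peak" "at_right peak" Z] peak_less by simp
  then have "\<forall>\<^sub>F x in at_right peak. ereal x < Z \<and> peak < x"
    using eventually_at_right_less[of peak] by eventually_elim simp
  then obtain x where x: "ereal x < Z" "peak < x"
    using eventually_happens[of _ "at_right peak"] by force
  define s where "s = c / z - G peak * (a / (2 * peak))"
  have diff: "tangent v - G v = (v - peak) * s" if "ereal v < Z" for v
  proof -
    have "G v = G peak - (v - peak) * (c / z)"
      using affine[OF that] affine[OF peak_less] by (simp add: algebra_simps diff_divide_distrib)
    then show ?thesis using peak_pos by (simp add: tangent_def s_def algebra_simps diff_divide_distrib)
  qed
  have "(x - peak) * s \<le> 0" using tangent_le[OF x(1)] diff[of x] x(1) by simp
  moreover have "(0 - peak) * s \<le> 0" using tangent_le[of 0] diff[of 0] Z_pos by (simp add: zero_ereal_def)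
  ultimately have "s = 0" using x(2) peak_pos
    by (smt (verit) mult_le_0_iff)
  then show ?thesis using diff[OF u] by simp
qed

section \<open>Moments of the tangent bound\<close>

text \<open>The square of \<open>u powr (a / 2) * tangent u\<close> divided by \<open>u\<close>,
  brought into the form whose antiderivative is known.\<close>

definition minorant :: "real \<Rightarrow> real" where
  "minorant u = u powr (a - 1) * (G peak * (1 + a / 2) - G peak * a / (2 * peak) * u)\<^sup>2"

lemma minorant_eq: "0 < u \<Longrightarrow> minorant u = (u powr (a / 2) * tangent u)\<^sup>2 / u"
proof -
  assume u: "0 < u"
  have "tangent u = G peak * (1 + a / 2) - G peak * a / (2 * peak) * u"
    using peak_pos by (simp add: tangent_def field_simps)
  then show ?thesis
    using u by (simp add: minorant_def power_mult_distrib powr_diff powr_half_squared)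
qed

lemma tangent_nonneg:
  assumes "u \<le> (1 + 2 / a) * peak"
  shows "0 \<le> tangent u"
proof -
  have "0 \<le> 1 + a / 2 * (1 - u / peak)"
    using assms peak_pos a_pos by (simp add: field_simps)
  then show ?thesis using G_pos[OF peak_less] by (simp add: tangent_def)
qed

lemma minorant_le:
  assumes "0 < u" "u < (1 + 2 / a) * peak"
  shows "minorant u \<le> (F u)\<^sup>2 / u"
proof -
  have "ereal u < Z" using less_le_trans[OF _ tangent_zero_le, of "ereal u"] assms(2) by simp
  then have "tangent u \<le> G u" by (rule tangent_le)
  then show ?thesis
    unfolding minorant_eq[OF assms(1)] F_def using assms tangent_nonneg[of u]
    by (intro divide_right_mono power_mono mult_left_mono) auto
qed

lemma F_peak_squared: "(F peak)\<^sup>2 = peak powr a * (G peak)\<^sup>2"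
  by (simp add: F_def power_mult_distrib powr_half_squared)

lemma set_integrable_minorant: "0 < x \<Longrightarrow> set_integrable lborel {0<..<x} minorant"
  unfolding minorant_def[abs_def] using set_integrable_powr_linear_squared[OF a_pos] .

text \<open>Scaling by the peak leaves \<open>(s * peak) powr a * (G peak)\<^sup>2\<close>, which is
  \<open>s powr a * (F peak)\<^sup>2\<close>, times a rational expression in a and s. The values s =
  1 and s = 1 + 2 / a produce \<open>R_const a / a\<close> and \<open>R_star a / a\<close>.\<close>

lemma
  assumes "0 < s"
  defines "J \<equiv> (s * peak) powr a * (G peak)\<^sup>2 *
      ((1 + a / 2)\<^sup>2 / a - 2 * (1 + a / 2) * (a / 2) * s / (a + 1) + (a / 2)\<^sup>2 * s\<^sup>2 / (a + 2))"
  shows set_integral_minorant: "(LBINT u:{0<..<s * peak}. minorant u) = J"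
    and nn_integral_minorant: "(\<integral>\<^sup>+u\<in>{0<..<s * peak}. ennreal (minorant u) \<partial>lborel) = ennreal J"
proof -
  define x \<alpha> \<gamma> q where "x = s * peak" and "\<alpha> = G peak * (1 + a / 2)"
    and "\<gamma> = G peak * a / (2 * peak)" and "q = (s * peak) powr a"
  have x: "0 < x" using assms peak_pos by (simp add: x_def)
  have pw: "x powr a = q" "x powr (a + 1) = x * q" "x powr (a + 2) = x\<^sup>2 * q"
    using x by (auto simp: q_def x_def powr_add)
  have \<gamma>x: "\<gamma> * x = G peak * (a / 2) * s" using peak_pos by (simp add: \<gamma>_def x_def)
  have "\<alpha>\<^sup>2 * x powr a / a - 2 * \<alpha> * \<gamma> * x powr (a + 1) / (a + 1) + \<gamma>\<^sup>2 * x powr (a + 2) / (a + 2)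
      = q * (\<alpha>\<^sup>2 * (1 / a) - 2 * \<alpha> * (\<gamma> * x) * (1 / (a + 1)) + (\<gamma> * x)\<^sup>2 * (1 / (a + 2)))"
    unfolding pw by (simp add: ring_distribs power_mult_distrib mult_ac)
  also have "\<dots> = q * (G peak)\<^sup>2 * ((1 + a / 2)\<^sup>2 * (1 / a)
      - 2 * (1 + a / 2) * (a / 2) * s * (1 / (a + 1)) + (a / 2)\<^sup>2 * s\<^sup>2 * (1 / (a + 2)))"
  proof -
    have "q * ((g * k)\<^sup>2 * i - 2 * (g * k) * (g * h * s) * i' + (g * h * s)\<^sup>2 * i'')
        = q * g\<^sup>2 * (k\<^sup>2 * i - 2 * k * h * s * i' + h\<^sup>2 * s\<^sup>2 * i'')" for g h k i i' i'' :: real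
      by (simp add: algebra_simps power2_eq_square)
    then show ?thesis unfolding \<alpha>_def \<gamma>x .
  qed
  also have "\<dots> = J" by (simp add: J_def q_def)
  finally have J: "\<alpha>\<^sup>2 * x powr a / a - 2 * \<alpha> * \<gamma> * x powr (a + 1) / (a + 1)
      + \<gamma>\<^sup>2 * x powr (a + 2) / (a + 2) = J" .
  show "(LBINT u:{0<..<s * peak}. minorant u) = J"
    using set_integral_powr_linear_squared[OF a_pos x, of \<alpha> \<gamma>]
    unfolding J by (simp add: minorant_def[abs_def] \<alpha>_def \<gamma>_def x_def)
  show "(\<integral>\<^sup>+u\<in>{0<..<s * peak}. ennreal (minorant u) \<partial>lborel) = ennreal J"
    using nn_integral_powr_linear_squared[OF a_pos x, of \<alpha> \<gamma>]
    unfolding J by (simp add: minorant_def[abs_def] \<alpha>_def \<gamma>_def x_def)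
qed

lemma set_integral_minorant_peak:
  "(LBINT u:{0<..<peak}. minorant u) = (F peak)\<^sup>2 / a * R_const a"
proof -
  have "(1 + a / 2)\<^sup>2 / a - 2 * (1 + a / 2) * (a / 2) * 1 / (a + 1) + (a / 2)\<^sup>2 * 1\<^sup>2 / (a + 2)
      = R_const a / a"
    unfolding R_const_def using a_pos
    by (simp add: divide_simps) (simp add: algebra_simps power2_eq_square)
  then show ?thesis
    using set_integral_minorant[of 1] by (simp add: F_peak_squared)
qed

lemma nn_integral_minorant_tangent_zero:
  "(\<integral>\<^sup>+u\<in>{0<..<(1 + 2 / a) * peak}. ennreal (minorant u) \<partial>lborel)
     = ennreal ((F peak)\<^sup>2 / a * R_star a)"
proof -
  define T where "T = (a + 2) / a"
  have T: "1 + 2 / a = T" "0 < T" using a_pos by (auto simp: T_def field_simps)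
  have "(1 + a / 2)\<^sup>2 / a - 2 * (1 + a / 2) * (a / 2) * T / (a + 1) + (a / 2)\<^sup>2 * T\<^sup>2 / (a + 2)
      = (a + 2) / (2 * (a + 1)) / a"
    unfolding T_def using a_pos
    by (simp add: divide_simps) (simp add: algebra_simps power2_eq_square)
  then show ?thesis
    using nn_integral_minorant[OF T(2)] T peak_pos
    by (simp add: F_peak_squared R_star_def powr_mult mult_ac flip: T_def)
qed

lemma set_integrable_F: "set_integrable lborel {0<..<peak} (\<lambda>u. (F u)\<^sup>2 / u)"
proof (rule set_integrable_bound)
  \<comment> \<open>The dominating function comes from \<open>G u \<le> G 0\<close>; it is the case
    of slope 0 of the known integral.\<close>
  show "set_integrable lborel {0<..<peak} (\<lambda>u. u powr (a - 1) * (G 0 - 0 * u)\<^sup>2)"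
    by (rule set_integrable_powr_linear_squared[OF a_pos peak_pos])
  have sub: "{0<..<peak} \<subseteq> {u. 0 \<le> u \<and> ereal u < Z}"
    using peak_less by (auto intro: less_trans[of "ereal _" "ereal peak"])
  have "continuous_on {0<..<peak} (\<lambda>u. (F u)\<^sup>2 / u)"
    by (intro continuous_intros continuous_on_subset[OF continuous_on_F sub]) auto
  then show "set_borel_measurable lborel {0<..<peak} (\<lambda>u. (F u)\<^sup>2 / u)"
    using set_measurable_continuous_on[of "{0<..<peak}" "\<lambda>u. (F u)\<^sup>2 / u"]
    by (simp add: set_borel_measurable_def)
  have "(F u)\<^sup>2 / u \<le> u powr (a - 1) * (G 0)\<^sup>2" if "u \<in> {0<..<peak}" for u
  proof -
    have u: "0 < u" "ereal u < Z" using that sub by auto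
    have "(F u)\<^sup>2 / u = u powr (a - 1) * (G u)\<^sup>2"
      using u by (simp add: F_def power_mult_distrib powr_diff powr_half_squared)
    also have "\<dots> \<le> u powr (a - 1) * (G 0)\<^sup>2"
      using G_antimono[of u 0] G_pos[of u] u by (intro mult_left_mono power_mono) auto
    finally show ?thesis .
  qed
  then show "AE u in lborel. u \<in> {0<..<peak} \<longrightarrow>
      norm ((F u)\<^sup>2 / u) \<le> norm (u powr (a - 1) * (G 0 - 0 * u)\<^sup>2)"
    by (intro AE_I2) auto
qed

lemma less_tangent_zero: "u < peak \<Longrightarrow> u < (1 + 2 / a) * peak"
proof -
  have "1 * peak < (1 + 2 / a) * peak"
    using peak_pos a_pos by (intro mult_strict_right_mono) auto
  then show "u < peak \<Longrightarrow> u < (1 + 2 / a) * peak" by linarith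
qed

lemma partial_moment_ge: "(F peak)\<^sup>2 / a * R_const a \<le> (LBINT u:{0<..<peak}. (F u)\<^sup>2 / u)"
  unfolding set_integral_minorant_peak[symmetric]
  using minorant_le less_tangent_zero
  by (intro set_integral_mono set_integrable_minorant set_integrable_F peak_pos) auto

lemma partial_moment_greater:
  assumes "strictly_midconvex_on {u. ereal u < Z} G"
  shows "(F peak)\<^sup>2 / a * R_const a < (LBINT u:{0<..<peak}. (F u)\<^sup>2 / u)"
proof -
  have less: "minorant u < (F u)\<^sup>2 / u" if "0 < u" "u < peak" for u
    unfolding minorant_eq[OF that(1)] F_def
    using that tangent_less[OF assms that(2)] tangent_nonneg[of u] less_tangent_zero[of u]
    by (intro divide_strict_right_mono power_strict_mono mult_strict_left_mono) auto
  let ?h = "\<lambda>u. (F u)\<^sup>2 / u - minorant u"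
  have int: "integrable lborel (\<lambda>u. indicator {0<..<peak} u *\<^sub>R ?h u)"
    using set_integral_diff(1)[OF set_integrable_F set_integrable_minorant[OF peak_pos]]
    by (simp add: set_integrable_def)
  have nonneg: "AE u in lborel. 0 \<le> indicator {0<..<peak} u *\<^sub>R ?h u"
    using less by (intro AE_I2) (auto split: split_indicator intro: less_imp_le)
  \<comment> \<open>Otherwise the nonnegative difference would vanish almost everywhere, although it
    is positive on an interval of positive measure.\<close>
  have "(LBINT u:{0<..<peak}. ?h u) \<noteq> 0"
  proof
    assume "(LBINT u:{0<..<peak}. ?h u) = 0"
    then have "AE u in lborel. indicator {0<..<peak} u *\<^sub>R ?h u = 0"
      using integral_nonneg_eq_0_iff_AE[OF int nonneg] by (simp add: set_lebesgue_integral_def)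
    then have "AE u in lborel. u \<notin> {0<..<peak}"
      by (rule AE_mp) (use less in \<open>force intro!: AE_I2\<close>)
    then have "emeasure lborel {0<..<peak} = 0"
      by (subst (asm) AE_iff_measurable[where N = "{0<..<peak}"]) auto
    then show False using peak_pos by simp
  qed
  moreover have "(LBINT u:{0<..<peak}. ?h u)
      = (LBINT u:{0<..<peak}. (F u)\<^sup>2 / u) - (F peak)\<^sup>2 / a * R_const a"
    using set_integral_diff(2)[OF set_integrable_F set_integrable_minorant[OF peak_pos]]
    by (simp add: set_integral_minorant_peak)
  ultimately show ?thesis using partial_moment_ge by linarith
qed

lemma partial_moment_eq:
  assumes "\<And>u. ereal u < Z \<Longrightarrow> G u = c * (1 - u / z)"
  shows "(LBINT u:{0<..<peak}. (F u)\<^sup>2 / u) = (F peak)\<^sup>2 / a * R_const a"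
  unfolding set_integral_minorant_peak[symmetric]
proof (intro set_lebesgue_integral_cong allI impI)
  fix u assume "u \<in> {0<..<peak}"
  then have "0 < u" "ereal u < Z" using less_trans[OF _ peak_less, of "ereal u"] by auto
  then show "(F u)\<^sup>2 / u = minorant u" by (simp add: minorant_eq F_def tangent_eq[OF assms])
qed simp

lemma F_ratio_eq:
  assumes "\<And>u. ereal u < Z \<Longrightarrow> G u = c * (1 - u / z)" "0 \<le> t" "ereal (t * peak) < Z"
  shows "F (t * peak) / F peak = t powr (a / 2) * (1 + a / 2 * (1 - t))"
proof -
  have "G (t * peak) = G peak * (1 + a / 2 * (1 - t))"
    using tangent_eq[OF assms(1,3)] peak_pos by (simp add: tangent_def)
  then show ?thesis
    using assms(2) peak_pos G_pos[OF peak_less] by (simp add: F_def powr_mult)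
qed

text \<open>The tangent bound accounts only for the part of \<open>S\<close> before the zero of the
  tangent. A strip beyond it on which \<open>\<bar>G u\<bar>\<close> is at least \<open>c\<close>
  adds a positive amount, which makes the inequality strict. The absolute value is there because
  \<open>G\<close> may be negative past its first zero.\<close>

lemma moment_greater:
  assumes xy: "(1 + 2 / a) * peak \<le> x" "x < y" "{x<..<y} \<subseteq> S" and S: "{0<..<x} \<subseteq> S"
    and c: "0 < c" "\<And>u. u \<in> {x<..<y} \<Longrightarrow> c \<le> \<bar>G u\<bar>"
    and fin: "(\<integral>\<^sup>+u\<in>S. ennreal ((F u)\<^sup>2 / u) \<partial>lborel) < \<infinity>"
  shows "(F peak)\<^sup>2 < a * enn2real (\<integral>\<^sup>+u\<in>S. ennreal ((F u)\<^sup>2 / u) \<partial>lborel) / R_star a"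
proof -
  let ?I = "\<integral>\<^sup>+u\<in>S. ennreal ((F u)\<^sup>2 / u) \<partial>lborel" and ?x = "(1 + 2 / a) * peak"
  let ?A = "(F peak)\<^sup>2 / a * R_star a"
  \<comment> \<open>On the strip \<open>u powr (a / 2)\<close> is at least its value at
    \<open>x\<close>, and 1 / u is at least 1 / y.\<close>
  define m where "m = (x powr (a / 2) * c)\<^sup>2 / y"
  have "0 < ?x" using a_pos peak_pos by (simp add: add_pos_pos)
  then have x: "0 < x" using xy(1) by linarith
  then have m_pos: "0 < m" using c(1) xy(2) by (simp add: m_def)
  have m_le: "m \<le> (F u)\<^sup>2 / u" if "u \<in> {x<..<y}" for u
  proof -
    have "x powr (a / 2) * c \<le> u powr (a / 2) * \<bar>G u\<bar>"
      using x that c a_pos by (intro mult_mono powr_mono2) auto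
    then have "x powr (a / 2) * c \<le> \<bar>F u\<bar>" by (simp add: F_def abs_mult)
    then have "(x powr (a / 2) * c)\<^sup>2 \<le> (F u)\<^sup>2"
      using c(1) by (metis abs_le_square_iff abs_of_nonneg less_imp_le mult_nonneg_nonneg powr_ge_zero)
    then show ?thesis unfolding m_def using x that by (intro frac_le) auto
  qed
  note m = m_pos m_le
  have R: "0 < R_star a" using a_pos by (simp add: R_star_def)
  have A: "0 \<le> ?A" using R a_pos by simp
  have meas: "(\<lambda>u. ennreal (minorant u) * indicator {0<..<?x} u) \<in> borel_measurable lborel"
    unfolding minorant_def by measurable
  have "ennreal (?A + m * (y - x)) = ennreal ?A + ennreal m * ennreal (y - x)"
    using A m(1) xy(2) by (simp add: ennreal_plus flip: ennreal_mult)
  also have "\<dots> = (\<integral>\<^sup>+u\<in>{0<..<?x}. ennreal (minorant u) \<partial>lborel) + (\<integral>\<^sup>+u\<in>{x<..<y}. ennreal m \<partial>lborel)"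
    unfolding nn_integral_minorant_tangent_zero using xy(2) by (simp add: nn_integral_cmult_indicator)
  also have "\<dots> = (\<integral>\<^sup>+u. ennreal (minorant u) * indicator {0<..<?x} u
      + ennreal m * indicator {x<..<y} u \<partial>lborel)"
    using meas by (intro nn_integral_add[symmetric]) auto
  also have "\<dots> \<le> ?I"
  proof (intro nn_integral_mono)
    fix u
    consider "u \<in> {0<..<?x}" | "u \<in> {x<..<y}" | "u \<notin> {0<..<?x}" "u \<notin> {x<..<y}" by blast
    then show "ennreal (minorant u) * indicator {0<..<?x} u + ennreal m * indicator {x<..<y} u
        \<le> ennreal ((F u)\<^sup>2 / u) * indicator S u"
    proof cases
      case 1
      then have "u \<in> S" "u \<notin> {x<..<y}" using xy(1) S by auto
      then show ?thesis using 1 minorant_le[of u] by (auto intro: ennreal_leI)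
    next
      case 2
      then have "u \<in> S" "u \<notin> {0<..<?x}" using xy(1,3) by auto
      then show ?thesis using 2 m(2)[of u] by (auto intro: ennreal_leI)
    qed auto
  qed
  finally have "enn2real (ennreal (?A + m * (y - x))) \<le> enn2real ?I"
    using fin by (intro enn2real_mono) auto
  then have "?A + m * (y - x) \<le> enn2real ?I"
    by (subst (asm) enn2real_ennreal) (use A m(1) xy(2) in auto)
  moreover have "0 < m * (y - x)" using m(1) xy(2) by simp
  ultimately have "?A < enn2real ?I" by linarith
  then show ?thesis using R a_pos by (simp add: field_simps)
qed

end

section \<open>Products over the zeros\<close>

lemma strict_antimono_on_mult_decr_logconcave:
  assumes f: "decr_logconcave_on X f" "strict_antimono_on X f" and g: "decr_logconcave_on X g"
  shows "strict_antimono_on X (\<lambda>u. f u * g u)"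
proof (rule monotone_onI)
  fix u v assume uv: "u \<in> X" "v \<in> X" "u < v"
  show "f v * g v < f u * g u"
    using monotone_onD[OF f(2) uv] decr_logconcave_onD(1)[OF f(1)]
      decr_logconcave_onD(1)[OF g] decr_logconcave_onD(2)[OF g, of u v] uv
    by (intro mult_less_le_imp_less) (auto intro: less_imp_le)
qed

lemma strict_antimono_on_linear_factor: "0 < z \<Longrightarrow> strict_antimono_on X (\<lambda>u::real. 1 - u / z)"
  by (rule monotone_onI) (simp add: divide_strict_right_mono)

lemma strict_antimono_on_exp: "0 < l \<Longrightarrow> strict_antimono_on X (\<lambda>u::real. exp (- l * u / 2))"
  by (rule monotone_onI) simp

lemma linear_factor_lessThan:
  assumes "0 < z" "x \<le> z"
  shows "decr_logconcave_on {..<x} (\<lambda>u. 1 - u / z) \<and> convex_on {..<x} (\<lambda>u. 1 - u / z)"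
  using assms decr_logconcave_on_subset[OF decr_logconcave_on_linear_factor]
  by (auto intro!: convex_on_linear_factor)

lemma convex_on_transfer: "convex_on X f \<Longrightarrow> (\<And>u. u \<in> X \<Longrightarrow> g u = f u) \<Longrightarrow> convex_on X g"
  by (auto simp: convex_on_def convex_def)

text \<open>Without its first factor the product stays positive up to the second zero
  \<open>\<zeta> 1\<close>, thus past the first one; this later yields nonzero values of the full
  product just beyond \<open>\<zeta> 0\<close>. For n = 1 the tail is the empty product and
  \<open>x\<close> is arbitrary.\<close>

lemma finite_product_tail:
  fixes \<zeta> :: "nat \<Rightarrow> real" and n :: nat
  assumes n: "1 \<le> n" and pos: "\<And>j. j < n \<Longrightarrow> 0 < \<zeta> j" and mono: "strict_mono_on {..<n} \<zeta>"
    and x: "if n = 1 then True else x \<le> \<zeta> 1"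
  defines "M \<equiv> \<lambda>u. \<Prod>j\<in>{1..<n}. 1 - u / \<zeta> j"
  shows "(\<Prod>j<n. 1 - u / \<zeta> j) = (1 - u / \<zeta> 0) * M u"
    and "decr_logconcave_on {..<x} M" and "convex_on {..<x} M"
    and "n \<noteq> 1 \<Longrightarrow> strict_antimono_on {..<x} M"
proof -
  have fac: "decr_logconcave_on {..<x} (\<lambda>u. 1 - u / \<zeta> j) \<and> convex_on {..<x} (\<lambda>u. 1 - u / \<zeta> j)"
    if "j \<in> {1..<n}" for j
  proof -
    have "\<zeta> 1 \<le> \<zeta> j"
      using that by (cases "j = 1") (auto intro!: less_imp_le strict_mono_onD[OF mono])
    then show ?thesis using that x pos by (intro linear_factor_lessThan) (auto split: if_splits)
  qed
  have "{..<n} = insert 0 {1..<n}" using n by auto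
  then show "(\<Prod>j<n. 1 - u / \<zeta> j) = (1 - u / \<zeta> 0) * M u" by (simp add: M_def)
  show "decr_logconcave_on {..<x} M"
    unfolding M_def using fac by (intro decr_logconcave_on_prod) blast
  show "convex_on {..<x} M"
    unfolding M_def using fac by (intro convex_on_prod_decr_logconcave) auto
  assume n1: "n \<noteq> 1"
  then have "{1..<n} = insert 1 {2..<n}" using n by auto
  then have "M = (\<lambda>u. (1 - u / \<zeta> 1) * (\<Prod>j\<in>{2..<n}. 1 - u / \<zeta> j))" by (auto simp: M_def)
  moreover have "strict_antimono_on {..<x} (\<lambda>u. (1 - u / \<zeta> 1) * (\<Prod>j\<in>{2..<n}. 1 - u / \<zeta> j))"
    using fac n n1 pos
    by (intro strict_antimono_on_mult_decr_logconcave strict_antimono_on_linear_factor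
        decr_logconcave_on_prod) auto
  ultimately show "strict_antimono_on {..<x} M" by simp
qed

text \<open>Each tail is the limit of its partial products and so inherits log-concavity and
  convexity. Strict decrease is lost in the limit; it is recovered by splitting off the factor with
  zero \<open>\<zeta> 1\<close> explicitly and treating the tail from index 2 as the other
  factor.\<close>

lemma infinite_product_tail:
  fixes \<zeta> :: "nat \<Rightarrow> real"
  assumes pos: "\<And>j. 0 < \<zeta> j" and mono: "strict_mono \<zeta>" and sum: "summable (\<lambda>j. 1 / \<zeta> j)"
  defines "M \<equiv> \<lambda>u. \<Prod>j. 1 - u / \<zeta> (Suc j)"
  shows "(\<Prod>j. 1 - u / \<zeta> j) = (1 - u / \<zeta> 0) * M u"
    and "decr_logconcave_on {..<\<zeta> 1} M" and "convex_on {..<\<zeta> 1} M"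
    and "strict_antimono_on {..<\<zeta> 1} M"
proof -
  have conv: "convergent_prod (\<lambda>j. 1 - u / \<zeta> (j + k))" for u k
  proof -
    have "summable (\<lambda>j. \<bar>u\<bar> * (1 / \<zeta> (j + k)))"
      using summable_ignore_initial_segment[OF sum, of k] by (rule summable_mult)
    moreover have "norm (1 - u / \<zeta> (j + k) - 1) = \<bar>u\<bar> * (1 / \<zeta> (j + k))" for j
      using pos[of "j + k"] by (simp add: abs_divide)
    ultimately show ?thesis
      by (intro abs_convergent_prod_imp_convergent_prod)
         (simp only: abs_convergent_prod_conv_summable)
  qed
  define P where "P k u = (\<Prod>j. 1 - u / \<zeta> (j + k))" for k u
  have lim: "(\<lambda>n. \<Prod>j\<le>n. 1 - u / \<zeta> (j + k)) \<longlonglongrightarrow> P k u" for k u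
    unfolding P_def using conv by (rule convergent_prod_LIMSEQ)
  have split: "P k u = (1 - u / \<zeta> k) * P (Suc k) u" for k u
  proof (rule LIMSEQ_unique)
    show "(\<lambda>n. \<Prod>j\<le>Suc n. 1 - u / \<zeta> (j + k)) \<longlonglongrightarrow> P k u"
      using lim by (rule LIMSEQ_Suc)
    show "(\<lambda>n. \<Prod>j\<le>Suc n. 1 - u / \<zeta> (j + k)) \<longlonglongrightarrow> (1 - u / \<zeta> k) * P (Suc k) u"
      using tendsto_mult[OF tendsto_const lim[of u "Suc k"]]
      unfolding prod.atMost_Suc_shift by simp
  qed
  have M: "M = P 1" by (auto simp: M_def P_def)
  show "(\<Prod>j. 1 - u / \<zeta> j) = (1 - u / \<zeta> 0) * M u"
    using split[of 0 u] by (simp add: P_def M)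
  have fac: "decr_logconcave_on {..<\<zeta> 1} (\<lambda>u. 1 - u / \<zeta> (j + k)) \<and>
      convex_on {..<\<zeta> 1} (\<lambda>u. 1 - u / \<zeta> (j + k))" if "1 \<le> k" for j k
    using that pos strict_mono_less_eq[OF mono, of 1 "j + k"] by (intro linear_factor_lessThan) auto
  \<comment> \<open>The factors are positive, and \<open>convergent_prod\<close> excludes divergence
    to 0.\<close>
  have Ppos: "0 < P k u" if "1 \<le> k" "u < \<zeta> 1" for k u
    unfolding P_def using conv decr_logconcave_onD(1)[OF conjunct1[OF fac[OF that(1)]]] that(2)
    by (intro less_0_prodinf) auto
  have dlc: "decr_logconcave_on {..<\<zeta> 1} (P k)" if "1 \<le> k" for k
    using fac[OF that] Ppos[OF that]
    by (intro decr_logconcave_on_LIMSEQ[OF _ _ lim] decr_logconcave_on_prod) auto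
  show "decr_logconcave_on {..<\<zeta> 1} M" unfolding M by (rule dlc) simp
  show "convex_on {..<\<zeta> 1} M"
    unfolding M by (intro convex_on_LIMSEQ[OF _ lim] convex_on_prod_decr_logconcave fac) auto
  have "strict_antimono_on {..<\<zeta> 1} (\<lambda>u. (1 - u / \<zeta> 1) * P 2 u)"
    using pos by (intro strict_antimono_on_mult_decr_logconcave strict_antimono_on_linear_factor
        dlc conjunct1[OF linear_factor_lessThan]) auto
  then show "strict_antimono_on {..<\<zeta> 1} M"
    unfolding M using split[of 1] by (simp add: numeral_2_eq_2 monotone_on_def)
qed

section \<open>From lobe data to the locale\<close>

text \<open>The function \<open>G\<close> of the overview. Without the power of \<open>u\<close> the
  formula is meaningful for negative arguments as well, as the locale requires.\<close>

fun profile :: "lobe_data \<Rightarrow> real \<Rightarrow> real" where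
  "profile (Finite_Endpoint C lam B b N \<zeta>) u =
     C * (B - u) powr (b / 2) * exp (- lam * u / 2) * (\<Prod>j<N. 1 - u / \<zeta> j)"
| "profile (Infinite_Endpoint C lam N \<zeta>) u = C * exp (- lam * u / 2) * zero_product N \<zeta> u"

lemma Phi_eq_profile: "Phi a p u = u powr (a / 2) * profile p u"
  by (cases p) auto

lemma damped_factor:
  assumes "0 < C" "0 \<le> l" and M: "decr_logconcave_on {..<x} M" "convex_on {..<x} M"
  shows "decr_logconcave_on {..<x} (\<lambda>u. C * exp (- l * u / 2) * M u)"
    and "convex_on {..<x} (\<lambda>u. C * exp (- l * u / 2) * M u)"
    and "0 < l \<or> strict_antimono_on {..<x} M \<Longrightarrow>
      strict_antimono_on {..<x} (\<lambda>u. C * exp (- l * u / 2) * M u)"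
proof -
  let ?e = "\<lambda>u. C * exp (- l * u / 2)"
  have e: "decr_logconcave_on {..<x} ?e" "convex_on {..<x} ?e"
    using assms by (intro decr_logconcave_on_mult convex_on_mult_decr_logconcave
        decr_logconcave_on_const decr_logconcave_on_exp convex_on_exp_linear;
        simp add: convex_on_const)+
  show "decr_logconcave_on {..<x} (\<lambda>u. ?e u * M u)"
    by (rule decr_logconcave_on_mult[OF e(1) M(1)])
  show "convex_on {..<x} (\<lambda>u. ?e u * M u)"
    by (rule convex_on_mult_decr_logconcave[OF e M])
  assume "0 < l \<or> strict_antimono_on {..<x} M"
  then show "strict_antimono_on {..<x} (\<lambda>u. ?e u * M u)"
  proof
    assume "0 < l"
    then have "strict_antimono_on {..<x} ?e"
      using assms(1) monotone_onD[OF strict_antimono_on_exp[of l "{..<x}"]] by (intro monotone_onI) auto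
    then show ?thesis by (rule strict_antimono_on_mult_decr_logconcave[OF e(1) _ M(1)])
  next
    assume "strict_antimono_on {..<x} M"
    then have "strict_antimono_on {..<x} (\<lambda>u. M u * ?e u)"
      by (rule strict_antimono_on_mult_decr_logconcave[OF M(1) _ e(1)])
    then show ?thesis by (simp add: mult.commute)
  qed
qed

text \<open>A common shape for both endpoint types. The linear factor that vanishes first is
  isolated, and the other factors remain positive and decreasing up to \<open>x\<close>, past
  \<open>z\<close>. The last two clauses locate the source of strict convexity: a positive endpoint
  exponent or a strictly decreasing \<open>M\<close>.\<close>

lemma profile_factorization:
  assumes "admissible p" "first_zero p \<noteq> \<infinity>"
  obtains z x B \<beta> M where "first_zero p = ereal z" "0 < z" "z < x" "x \<le> B" "0 \<le> \<beta>"
    "ereal x \<le> endpoint p" "decr_logconcave_on {..<x} M" "convex_on {..<x} M"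
    "\<And>u. u < B \<Longrightarrow> profile p u = (1 - u / z) * ((B - u) powr \<beta> * M u)"
    "\<not> single_factor_form p \<Longrightarrow> 0 < \<beta> \<or> strict_antimono_on {..<x} M"
    "single_factor_form p \<Longrightarrow> \<beta> = 0 \<and> (\<exists>c. \<forall>u. M u = c)"
proof (cases p)
  case (Finite_Endpoint C l B b n \<zeta>)
  have adm: "0 < C" "0 \<le> l" "0 < B" "0 \<le> b" "1 \<le> n" "\<And>j. j < n \<Longrightarrow> 0 < \<zeta> j \<and> \<zeta> j < B"
    "strict_mono_on {..<n} \<zeta>"
    using assms(1) Finite_Endpoint by auto
  define x where "x = (if n = 1 then B else \<zeta> 1)"
  have x: "\<zeta> 0 < x" "x \<le> B" "if n = 1 then True else x \<le> \<zeta> 1"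
    using adm(5) adm(6)[of 0] adm(6)[of 1] strict_mono_onD[OF adm(7), of 0 1] by (auto simp: x_def)
  note tail = finite_product_tail[OF adm(5) _ adm(7) x(3)]
  define M where "M = (\<lambda>u. C * exp (- l * u / 2) * (\<Prod>j\<in>{1..<n}. 1 - u / \<zeta> j))"
  note damped = damped_factor[OF adm(1,2) tail(2,3)]
  show ?thesis
  proof (rule that[of "\<zeta> 0" x B "b / 2" M])
    show "profile p u = (1 - u / \<zeta> 0) * ((B - u) powr (b / 2) * M u)" for u
      using tail(1)[of u] adm(6) by (simp add: Finite_Endpoint M_def)
    show "0 < b / 2 \<or> strict_antimono_on {..<x} M" if "\<not> single_factor_form p"
      using that damped(3) tail(4) adm unfolding M_def Finite_Endpoint by fastforce
    show "b / 2 = 0 \<and> (\<exists>c. \<forall>u. M u = c)" if "single_factor_form p"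
      using that by (auto simp: Finite_Endpoint M_def)
    show "decr_logconcave_on {..<x} M" "convex_on {..<x} M"
      unfolding M_def using damped(1,2) adm(6) by auto
  qed (use x adm(4,5) adm(6)[of 0] Finite_Endpoint in auto)
next
  case (Infinite_Endpoint C l N \<zeta>)
  have adm: "0 < C" "0 \<le> l" "N \<noteq> 0" "\<And>j. enat j < N \<Longrightarrow> 0 < \<zeta> j"
    "strict_mono_on {j. enat j < N} \<zeta>" "N = \<infinity> \<Longrightarrow> summable (\<lambda>j. 1 / \<zeta> j)"
    using assms Infinite_Endpoint by auto
  have "\<exists>x M. \<zeta> 0 < x \<and> decr_logconcave_on {..<x} M \<and> convex_on {..<x} M
      \<and> (\<forall>u. zero_product N \<zeta> u = (1 - u / \<zeta> 0) * M u)
      \<and> (N \<noteq> 1 \<longrightarrow> strict_antimono_on {..<x} M) \<and> (N = 1 \<longrightarrow> (\<forall>u. M u = 1))"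
  proof (cases N)
    case (enat n)
    have n: "1 \<le> n" "\<And>j. j < n \<Longrightarrow> 0 < \<zeta> j" "strict_mono_on {..<n} \<zeta>"
      using adm enat by (auto simp: zero_enat_def lessThan_def)
    \<comment> \<open>With a single factor any point past its zero will do.\<close>
    define x where "x = (if n = 1 then \<zeta> 0 + 1 else \<zeta> 1)"
    have x: "\<zeta> 0 < x" "if n = 1 then True else x \<le> \<zeta> 1"
      using n(1) strict_mono_onD[OF n(3), of 0 1] by (auto simp: x_def)
    show ?thesis
      using finite_product_tail[OF n x(2)] x(1) enat
      by (intro exI[of _ x] exI[of _ "\<lambda>u. \<Prod>j\<in>{1..<n}. 1 - u / \<zeta> j"])
         (auto simp: zero_product_def one_enat_def)
  next
    case infinity
    have "\<And>j. 0 < \<zeta> j" "strict_mono \<zeta>" "summable (\<lambda>j. 1 / \<zeta> j)"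
      using adm infinity by auto
    from infinite_product_tail[OF this] strict_monoD[OF this(2), of 0 1] infinity
    show ?thesis
      by (intro exI[of _ "\<zeta> 1"] exI[of _ "\<lambda>u. \<Prod>j. 1 - u / \<zeta> (Suc j)"])
         (auto simp: zero_product_def)
  qed
  then obtain x M0 where x: "\<zeta> 0 < x" and M0: "decr_logconcave_on {..<x} M0" "convex_on {..<x} M0"
    and eq: "\<And>u. zero_product N \<zeta> u = (1 - u / \<zeta> 0) * M0 u"
    and strict: "N \<noteq> 1 \<Longrightarrow> strict_antimono_on {..<x} M0" and single: "N = 1 \<Longrightarrow> (\<forall>u. M0 u = 1)"
    by blast
  define M where "M = (\<lambda>u. C * exp (- l * u / 2) * M0 u)"
  note damped = damped_factor[OF adm(1,2) M0]
  show ?thesis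
  proof (rule that[of "\<zeta> 0" x x 0 M])
    \<comment> \<open>There is no endpoint power here: \<open>(x - u) powr 0\<close> is 1 as long as
      u < x, whereas \<open>0 powr 0 = 0\<close>.\<close>
    show "profile p u = (1 - u / \<zeta> 0) * ((x - u) powr 0 * M u)" if "u < x" for u
      using eq[of u] that by (simp add: Infinite_Endpoint M_def)
    show "0 < (0::real) \<or> strict_antimono_on {..<x} M" if "\<not> single_factor_form p"
      using that damped(3) strict adm unfolding M_def Infinite_Endpoint by fastforce
    show "(0::real) = 0 \<and> (\<exists>c. \<forall>u. M u = c)" if "single_factor_form p"
      using that single by (auto simp: Infinite_Endpoint M_def)
    show "decr_logconcave_on {..<x} M" "convex_on {..<x} M"
      unfolding M_def using damped(1,2) by auto
    show "0 < \<zeta> 0" using adm(3) adm(4)[of 0] by (simp add: zero_enat_def[symmetric])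
  qed (use x adm(3) Infinite_Endpoint in auto)
qed

lemma admissible_lobe:
  assumes a: "0 < a" and p: "admissible p"
  shows lobe_profile: "lobe a (first_zero p) (profile p)"
    and strictly_midconvex_on_profile: "\<not> single_factor_form p \<Longrightarrow>
      strictly_midconvex_on {u. ereal u < first_zero p} (profile p)"
    and affine_profile: "single_factor_form p \<Longrightarrow>
      \<exists>c z. \<forall>u. ereal u < first_zero p \<longrightarrow> profile p u = c * (1 - u / z)"
    and profile_bounded_below: "ereal t \<le> first_zero p \<Longrightarrow>
      \<exists>x y c. t \<le> x \<and> x < y \<and> ereal y \<le> endpoint p \<and> 0 < c \<and> (\<forall>u\<in>{x<..<y}. c \<le> \<bar>profile p u\<bar>)"
proof -
  have "lobe a (first_zero p) (profile p) \<and>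
    (\<not> single_factor_form p \<longrightarrow> strictly_midconvex_on {u. ereal u < first_zero p} (profile p)) \<and>
    (single_factor_form p \<longrightarrow> (\<exists>c z. \<forall>u. ereal u < first_zero p \<longrightarrow> profile p u = c * (1 - u / z))) \<and>
    (ereal t \<le> first_zero p \<longrightarrow>
      (\<exists>x y c. t \<le> x \<and> x < y \<and> ereal y \<le> endpoint p \<and> 0 < c \<and> (\<forall>u\<in>{x<..<y}. c \<le> \<bar>profile p u\<bar>)))"
  proof (cases "first_zero p = \<infinity>")
    case True
    then obtain C l \<zeta> where p_eq: "p = Infinite_Endpoint C l 0 \<zeta>"
      by (cases p) (auto split: if_splits)
    have C: "0 < C" and l: "0 < l" using p p_eq by auto
    have prof: "profile p = (\<lambda>u. C * exp (- l * u / 2))"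
      by (auto simp: p_eq zero_product_def zero_enat_def)
    have dlc: "decr_logconcave_on UNIV (profile p)"
      unfolding prof using C l by (intro decr_logconcave_on_mult decr_logconcave_on_const decr_logconcave_on_exp) auto
    have convex: "convex_on UNIV (profile p)"
      unfolding prof using C l
      by (intro convex_on_mult_decr_logconcave decr_logconcave_on_const decr_logconcave_on_exp
          convex_on_exp_linear) (auto simp: convex_on_const)
    have strict: "strictly_midconvex_on UNIV (profile p)"
    proof -
      have "strictly_midconvex_on UNIV (\<lambda>u. exp (- l * u / 2) * C)"
        using C l
        by (intro strictly_midconvex_on_mult_convex decr_logconcave_on_const decr_logconcave_on_exp
          convex_on_exp_linear strictly_midconvex_on_exp) (auto simp: convex_on_const)
      then show ?thesis by (simp add: prof mult.commute)
    qed
    have decay: "u powr (a / 2) * profile p u \<le> (a / l) powr (a / 2) * profile p (a / l)"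
      if u: "a / l \<le> u" for u
    proof -
      \<comment> \<open>\<open>a / l\<close> maximizes
        \<open>u powr (a / 2) * exp (- l * u / 2)\<close>; the estimate reduces to ln y \<le> y - 1
        with y = u / c.\<close>
      define c where "c = a / l"
      have c: "0 < c" "c \<le> u" "l = a / c" using a l u by (auto simp: c_def)
      have "a / 2 * ln (u / c) \<le> a / 2 * (u / c - 1)"
        using a c by (intro mult_left_mono ln_le_minus_one) auto
      also have "\<dots> = l * u / 2 - l * c / 2" using c by (simp add: field_simps)
      finally have "(u / c) powr (a / 2) \<le> exp (l * u / 2 - l * c / 2)"
        using c by (simp add: powr_def)
      then have "c powr (a / 2) * (u / c) powr (a / 2) \<le> c powr (a / 2) * exp (l * u / 2 - l * c / 2)"
        by (intro mult_left_mono) auto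
      moreover have "c powr (a / 2) * (u / c) powr (a / 2) = u powr (a / 2)"
        using c by (simp flip: powr_mult)
      ultimately have "u powr (a / 2) * exp (- l * u / 2)
          \<le> c powr (a / 2) * exp (l * u / 2 - l * c / 2) * exp (- l * u / 2)"
        by (intro mult_right_mono) auto
      also have "\<dots> = c powr (a / 2) * exp (- l * c / 2)"
        by (simp add: mult.assoc flip: exp_add)
      finally show ?thesis using C unfolding prof c_def[symmetric] by simp
    qed
    have "lobe a (first_zero p) (profile p)"
      using True a dlc convex decay l
      by unfold_locales (auto intro!: exI[of _ "a / l"])
    moreover have "profile p (t + 1) \<le> \<bar>profile p u\<bar>" if "u \<in> {t<..<t+1}" for u
      using decr_logconcave_onD(2)[OF dlc, of u "t + 1"] that by auto
    then have "\<exists>x y c. t \<le> x \<and> x < y \<and> ereal y \<le> endpoint p \<and> 0 < c \<and> (\<forall>u\<in>{x<..<y}. c \<le> \<bar>profile p u\<bar>)"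
      using decr_logconcave_onD(1)[OF dlc, of "t + 1"] p_eq
      by (intro exI[of _ t] exI[of _ "t + 1"] exI[of _ "profile p (t + 1)"]) auto
    moreover have "\<not> single_factor_form p" using p_eq by simp
    ultimately show ?thesis using strict True by simp
  next
    case False
    obtain z x B \<beta> M where fz: "first_zero p = ereal z" and z: "0 < z" "z < x" and B: "x \<le> B"
      and \<beta>: "0 \<le> \<beta>" and ep: "ereal x \<le> endpoint p"
      and M: "decr_logconcave_on {..<x} M" "convex_on {..<x} M"
      and prof: "\<And>u. u < B \<Longrightarrow> profile p u = (1 - u / z) * ((B - u) powr \<beta> * M u)"
      and strict: "\<not> single_factor_form p \<Longrightarrow> 0 < \<beta> \<or> strict_antimono_on {..<x} M"
      and single: "single_factor_form p \<Longrightarrow> \<beta> = 0 \<and> (\<exists>c. \<forall>u. M u = c)"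
      using profile_factorization[OF p False] by metis
    \<comment> \<open>Two groupings: \<open>H\<close> omits the linear factor and stays positive up
      to \<open>x\<close>, past the first zero; \<open>K\<close> joins the endpoint power to the
      linear factor, because that power alone need not be convex.\<close>
    define H where "H = (\<lambda>u. (B - u) powr \<beta> * M u)"
    define K where "K = (\<lambda>u. (1 - u / z) * (B - u) powr \<beta>)"
    have sub: "{..<z} \<subseteq> {..<x}" "{..<x} \<subseteq> {..<B}" "{..<z} \<subseteq> {..<B}" using z B by auto
    have H: "decr_logconcave_on {..<x} H"
      unfolding H_def using M \<beta> sub
      by (intro decr_logconcave_on_mult) (auto intro: decr_logconcave_on_subset[OF decr_logconcave_on_powr])
    have Mz: "decr_logconcave_on {..<z} M" "convex_on {..<z} M"
      using M sub(1) by (auto intro: decr_logconcave_on_subset convex_on_subset)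
    have K: "decr_logconcave_on {..<z} K" "convex_on {..<z} K"
      unfolding K_def using z B \<beta> sub
      by (auto intro!: decr_logconcave_on_mult decr_logconcave_on_linear_factor convex_on_linear_powr
          intro: decr_logconcave_on_subset[OF decr_logconcave_on_powr])
    have profH: "profile p u = (1 - u / z) * H u" if "u < x" for u
      using prof[of u] that B by (simp add: H_def)
    have profK: "profile p u = K u * M u" if "u < z" for u
      using prof[of u] that B z by (simp add: K_def)
    have dom: "{u. ereal u < first_zero p} = {..<z}" by (auto simp: fz)
    have dlc: "decr_logconcave_on {..<z} (profile p)"
    proof -
      have "decr_logconcave_on {..<z} (\<lambda>u. K u * M u)" using K Mz by (intro decr_logconcave_on_mult)
      moreover have "(u + v) / 2 < z" if "u < z" "v < z" for u v using that by simp
      ultimately show ?thesis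
        unfolding decr_logconcave_on_def monotone_on_def by (simp add: profK)
    qed
    have convex: "convex_on {..<z} (profile p)"
    proof -
      have "convex_on {..<z} (\<lambda>u. K u * M u)" using K Mz by (intro convex_on_mult_decr_logconcave)
      then show ?thesis by (rule convex_on_transfer) (simp add: profK)
    qed
    have lobe: "lobe a (first_zero p) (profile p)"
    proof (unfold_locales, goal_cases)
      \<comment> \<open>This goal is the chord bound \<open>upper\<close>, which follows from
        \<open>H u \<le> H 0\<close>.\<close>
      case (6 z' u)
      then have "z' = z" using fz by simp
      have "H u \<le> H 0" using decr_logconcave_onD(2)[OF H, of 0 u] 6 z \<open>z' = z\<close> by auto
      then have "(1 - u / z) * H u \<le> (1 - u / z) * H 0"
        using 6 z \<open>z' = z\<close> by (intro mult_left_mono) auto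
      then show ?case using profH[of u] profH[of 0] 6 z \<open>z' = z\<close> by (simp add: mult.commute)
    qed (use a z fz dlc convex profH dom in auto)
    have "strictly_midconvex_on {..<z} (\<lambda>u. K u * M u)" if "\<not> single_factor_form p"
    proof (cases "0 < \<beta>")
      case True
      then show ?thesis
        using K Mz z B strictly_midconvex_on_linear_powr[of z B \<beta>]
        by (intro strictly_midconvex_on_mult_convex) (auto simp: K_def)
    next
      \<comment> \<open>With \<beta> = 0 the factor \<open>K\<close> is merely linear, so strictness
        must come from the strict decrease of \<open>M\<close>.\<close>
      case False
      then have "\<beta> = 0" "strict_antimono_on {..<x} M" using \<beta> strict[OF that] by auto
      moreover have "strict_antimono_on {..<z} K"
        using monotone_onD[OF strict_antimono_on_linear_factor[OF z(1), of "{..<z}"]] \<open>\<beta> = 0\<close> z B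
        by (intro monotone_onI) (auto simp: K_def)
      ultimately show ?thesis
        using K Mz sub(1) by (intro strictly_midconvex_on_mult_decreasing) (auto intro: monotone_on_subset)
    qed
    then have strict': "strictly_midconvex_on {..<z} (profile p)" if "\<not> single_factor_form p"
      using that profK unfolding strictly_midconvex_on_def by simp
    have affine: "\<exists>c z. \<forall>u. ereal u < first_zero p \<longrightarrow> profile p u = c * (1 - u / z)"
      if "single_factor_form p"
    proof -
      obtain c where "\<forall>u. M u = c" using single[OF \<open>single_factor_form p\<close>] by blast
      then have "profile p u = c * (1 - u / z)" if "u < z" for u
        using profK[OF that] single[OF \<open>single_factor_form p\<close>] that z B by (simp add: K_def)
      then show ?thesis using fz by auto
    qed
    \<comment> \<open>\<open>v\<close> and \<open>w\<close> cut the interval from \<open>z\<close>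
      to \<open>x\<close> into thirds. On the middle third \<open>u / z - 1\<close> exceeds its
      value at \<open>v\<close>, and \<open>H\<close> is at least its value at
      \<open>w\<close>.\<close>
    define v w c where "v = (2 * z + x) / 3" and "w = (z + 2 * x) / 3" and "c = (v / z - 1) * H w"
    have vw: "z < v" "v < w" "w < x" using z by (auto simp: v_def w_def)
    have Hw: "0 < H w" using decr_logconcave_onD(1)[OF H, of w] vw by simp
    have c: "0 < c" using Hw vw z by (simp add: c_def)
    have "c \<le> \<bar>profile p u\<bar>" if u: "u \<in> {v<..<w}" for u
    proof -
      have "H w \<le> H u" using decr_logconcave_onD(2)[OF H, of u w] u vw by auto
      moreover have "v / z - 1 \<le> u / z - 1" using u z by (simp add: divide_right_mono)
      ultimately have "c \<le> (u / z - 1) * H u"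
        unfolding c_def using Hw vw z u by (intro mult_mono) auto
      also have "\<dots> = - profile p u" using profH[of u] u vw by (simp add: algebra_simps)
      finally show ?thesis by simp
    qed
    then have "\<exists>x y c. t \<le> x \<and> x < y \<and> ereal y \<le> endpoint p \<and> 0 < c \<and> (\<forall>u\<in>{x<..<y}. c \<le> \<bar>profile p u\<bar>)"
      if "ereal t \<le> first_zero p"
      using that fz vw c ep
      by (intro exI[of _ v] exI[of _ w] exI[of _ c]) (auto intro: order_trans[of _ "ereal x"])
    then show ?thesis using lobe strict' affine dom by simp
  qed
  then show "lobe a (first_zero p) (profile p)"
    and "\<not> single_factor_form p \<Longrightarrow> strictly_midconvex_on {u. ereal u < first_zero p} (profile p)"
    and "single_factor_form p \<Longrightarrow>
      \<exists>c z. \<forall>u. ereal u < first_zero p \<longrightarrow> profile p u = c * (1 - u / z)"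
    and "ereal t \<le> first_zero p \<Longrightarrow>
      \<exists>x y c. t \<le> x \<and> x < y \<and> ereal y \<le> endpoint p \<and> 0 < c \<and> (\<forall>u\<in>{x<..<y}. c \<le> \<bar>profile p u\<bar>)"
    by blast+
qed

lemma
  assumes "0 < a" "admissible p"
  shows max_point_eq: "max_point a p = lobe.peak a (first_zero p) (profile p)"
    and Phi_eq_F: "Phi a p = lobe.F a (profile p)"
proof -
  interpret lobe a "first_zero p" "profile p" by (rule lobe_profile[OF assms])
  show F: "Phi a p = F" by (auto simp: Phi_eq_profile F_def)
  show "max_point a p = peak" by (simp add: max_point_def peak_def F)
qed

section \<open>The one-zero family\<close>

text \<open>For 0 < u < \<open>B\<close> the resulting function is
  \<open>u powr (a / 2) * (1 - u)\<close>, so \<open>B\<close> influences only the range of the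
  inverse moment. The constant sequence of zeros is admissible, since strict monotonicity is
  demanded on a single index.\<close>

definition one_zero :: "real \<Rightarrow> lobe_data" where
  "one_zero B = Finite_Endpoint 1 0 B 0 1 (\<lambda>_. 1)"

lemma
  assumes "1 < B"
  shows admissible_one_zero: "admissible (one_zero B)"
    and single_factor_one_zero: "single_factor_form (one_zero B)"
    and first_zero_one_zero: "first_zero (one_zero B) = 1"
    and profile_one_zero: "u < B \<Longrightarrow> profile (one_zero B) u = 1 - u"
  using assms by (auto simp: one_zero_def strict_mono_on_def one_ereal_def)

lemma max_value_one_zero:
  assumes a: "0 < a" and B: "1 < B"
  shows "(max_value a (one_zero B))\<^sup>2 = (a / (a + 2)) powr a * (2 / (a + 2))\<^sup>2"
proof -
  let ?p = "one_zero B"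
  note adm = admissible_one_zero[OF B]
  interpret lobe a "first_zero ?p" "profile ?p" by (rule lobe_profile[OF a adm])
  have fz: "first_zero ?p = 1" by (rule first_zero_one_zero[OF B])
  have G: "profile ?p u = 1 * (1 - u / 1)" if "ereal u < first_zero ?p" for u
    using that B profile_one_zero[OF B, of u] unfolding fz one_ereal_def by simp
  have Gp: "profile ?p peak = 1 - peak" using G[OF peak_less] by simp
  \<comment> \<open>The tangent coincides with 1 - u, and its value at 0 determines the
    peak.\<close>
  have "tangent 0 = 1" using tangent_eq[OF G, of 0] G[of 0] Z_pos by (simp add: zero_ereal_def)
  then have "(1 - peak) * (1 + a / 2) = 1" by (simp add: tangent_def Gp)
  then have "peak = a / (a + 2)" using a by (simp add: field_simps)
  moreover from this have "1 - peak = 2 / (a + 2)" using a by (simp add: field_simps)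
  ultimately show ?thesis
    using F_peak_squared Gp unfolding max_value_def max_point_eq[OF a adm] Phi_eq_F[OF a adm] by simp
qed

lemma inverse_moment_one_zero:
  assumes a: "0 < a" and B: "1 < B"
  defines "Q \<equiv> B powr a / a - 2 * B powr (a + 1) / (a + 1) + B powr (a + 2) / (a + 2)"
  shows "inverse_moment a (one_zero B) = ennreal Q" and "0 \<le> Q"
proof -
  have B0: "0 < B" using B by simp
  have "inverse_moment a (one_zero B)
      = (\<integral>\<^sup>+u\<in>{0<..<B}. ennreal (u powr (a - 1) * (1 - 1 * u)\<^sup>2) \<partial>lborel)"
    unfolding inverse_moment_def
  proof (intro set_nn_integral_cong)
    show "{u. 0 < u \<and> ereal u < endpoint (one_zero B)} = {0<..<B}"
      by (auto simp: one_zero_def)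
    then show "ennreal ((Phi a (one_zero B) u)\<^sup>2 / u) = ennreal (u powr (a - 1) * (1 - 1 * u)\<^sup>2)"
      if "u \<in> space lborel \<inter> {u. 0 < u \<and> ereal u < endpoint (one_zero B)}" for u
      using that profile_one_zero[OF B, of u]
      by (simp add: Phi_eq_profile power_mult_distrib powr_half_squared powr_diff)
  qed simp
  then show "inverse_moment a (one_zero B) = ennreal Q"
    unfolding nn_integral_powr_linear_squared[OF a B0] by (simp add: Q_def)
  have "0 \<le> (LBINT u:{0<..<B}. u powr (a - 1) * (1 - 1 * u)\<^sup>2)"
    by (auto simp: set_lebesgue_integral_def intro!: integral_nonneg_AE)
  then show "0 \<le> Q"
    unfolding set_integral_powr_linear_squared[OF a B0] by (simp add: Q_def)
qed

text \<open>As the endpoint decreases to 1, the moment over the part beyond the zero disappears,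
  while the maximum does not change. The limit \<open>Q 1\<close> is the Euler beta integral with
  parameters a and 3. The endpoint 1 itself is inadmissible, because zeros lie strictly
  inside.\<close>

lemma one_zero_extremizing:
  assumes a: "0 < a"
  defines "p \<equiv> \<lambda>n::nat. one_zero (1 + 1 / real (Suc n))"
  shows "admissible (p n)" "inverse_moment a (p n) < \<infinity>"
    and "(\<lambda>n. a * enn2real (inverse_moment a (p n)) / (max_value a (p n))\<^sup>2) \<longlonglongrightarrow> R_star a"
proof -
  define Q where "Q B = B powr a / a - 2 * B powr (a + 1) / (a + 1) + B powr (a + 2) / (a + 2)" for B
  define A where "A = (a / (a + 2)) powr a * (2 / (a + 2))\<^sup>2"
  have B: "1 < 1 + 1 / real (Suc n)" for n by simp
  show "admissible (p n)" unfolding p_def by (rule admissible_one_zero[OF B])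
  show "inverse_moment a (p n) < \<infinity>"
    unfolding p_def inverse_moment_one_zero(1)[OF a B] by simp
  have eq: "a * enn2real (inverse_moment a (p n)) / (max_value a (p n))\<^sup>2
      = a * Q (1 + 1 / real (Suc n)) / A" for n
    unfolding p_def max_value_one_zero[OF a B] A_def inverse_moment_one_zero(1)[OF a B] Q_def
    using inverse_moment_one_zero(2)[OF a B[of n]] by simp
  have "(\<lambda>n. 1 + 1 / real (Suc n)) \<longlonglongrightarrow> 1 + 0"
    by (intro tendsto_add tendsto_const lim_1_over_n[THEN LIMSEQ_Suc])
  then have B_lim: "(\<lambda>n. 1 + 1 / real (Suc n)) \<longlonglongrightarrow> 1" by simp
  have "isCont Q 1" unfolding Q_def[abs_def] using a by (intro continuous_intros) auto
  then have "(\<lambda>n. Q (1 + 1 / real (Suc n))) \<longlonglongrightarrow> Q 1"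
    using B_lim by (rule isCont_tendsto_compose)
  moreover have "A \<noteq> 0" using a by (simp add: A_def)
  ultimately have "(\<lambda>n. a * Q (1 + 1 / real (Suc n)) / A) \<longlonglongrightarrow> a * Q 1 / A"
    by (intro tendsto_intros)
  moreover have "a * Q 1 / A = R_star a"
  proof -
    define P where "P = ((a + 2) / a) powr a"
    have P: "0 < P" using a by (simp add: P_def)
    have "(a / (a + 2)) powr a = 1 / P"
      using a by (simp add: P_def powr_divide)
    then have "A = 4 / (P * (a + 2)\<^sup>2)"
      by (simp add: A_def power_divide)
    moreover have "Q 1 = 2 / (a * (a + 1) * (a + 2))"
      using a by (simp add: Q_def divide_simps) (simp add: algebra_simps)
    ultimately have "a * Q 1 / A = a * (2 / (a * (a + 1) * (a + 2))) / (4 / (P * (a + 2)\<^sup>2))"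
      by simp
    also have "\<dots> = P * (a + 2) / (2 * (a + 1))"
      using a P by (simp add: divide_simps) (simp add: algebra_simps power2_eq_square)
    finally have "a * Q 1 / A = P * (a + 2) / (2 * (a + 1))" .
    then show ?thesis by (simp add: R_star_def P_def mult.commute)
  qed
  ultimately show "(\<lambda>n. a * enn2real (inverse_moment a (p n)) / (max_value a (p n))\<^sup>2) \<longlonglongrightarrow> R_star a"
    unfolding eq by simp
qed

section \<open>Sharp inequalities\<close>

lemma lobe_ratio_ge:
  assumes "0 < a" "admissible p" "t \<in> {0..1 + 2 / a}"
  shows "t powr (a / 2) * (1 + a / 2 * (1 - t)) \<le> Phi a p (t * max_point a p) / max_value a p"
proof -
  interpret lobe a "first_zero p" "profile p" by (rule lobe_profile[OF assms(1,2)])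
  show ?thesis
    using F_ratio_ge[OF assms(3)]
    unfolding max_value_def max_point_eq[OF assms(1,2)] Phi_eq_F[OF assms(1,2)] .
qed

text \<open>On the lobe the affine \<open>G\<close> is its own tangent; the remaining value t = 1 +
  2 / a corresponds to the zero itself, where both sides vanish. The endpoint 2 is an arbitrary
  choice above 1.\<close>

lemma lobe_ratio_eq_one_zero:
  assumes a: "0 < a" and t: "t \<in> {0..1 + 2 / a}"
  defines "p \<equiv> one_zero 2"
  shows "Phi a p (t * max_point a p) / max_value a p = t powr (a / 2) * (1 + a / 2 * (1 - t))"
proof -
  have adm: "admissible p" unfolding p_def by (rule admissible_one_zero) simp
  interpret lobe a "first_zero p" "profile p" by (rule lobe_profile[OF a adm])
  have fz: "first_zero p = ereal 1" unfolding p_def by (simp add: first_zero_one_zero one_ereal_def)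
  have G: "profile p u = 1 * (1 - u / 1)" if "ereal u < first_zero p" for u
    using that profile_one_zero[of 2 u] unfolding fz by (simp add: p_def)
  have le: "t * peak \<le> (1 + 2 / a) * peak" using t peak_pos by (intro mult_right_mono) auto
  have "F (t * peak) / F peak = t powr (a / 2) * (1 + a / 2 * (1 - t))"
  proof (cases "ereal (t * peak) < first_zero p")
    case True
    then show ?thesis using t by (intro F_ratio_eq[OF G]) auto
  next
    case False
    then have "t * peak = 1" "(1 + 2 / a) * peak = 1"
      using le tangent_zero_le unfolding fz by auto
    then have "t = 1 + 2 / a" using peak_pos by (metis less_irrefl mult_right_cancel)
    then have "1 + a / 2 * (1 - t) = 0" using a by simp
    moreover have "F (t * peak) = 0" using zero[OF fz] by (simp add: F_def \<open>t * peak = 1\<close>)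
    ultimately show ?thesis by simp
  qed
  then show ?thesis
    unfolding max_value_def max_point_eq[OF a adm] Phi_eq_F[OF a adm] .
qed

lemma max_value_pos:
  assumes "0 < a" "admissible p"
  shows "0 < max_value a p"
proof -
  interpret lobe a "first_zero p" "profile p" by (rule lobe_profile[OF assms])
  show ?thesis
    using F_peak_pos unfolding max_value_def max_point_eq[OF assms] Phi_eq_F[OF assms] .
qed

lemma
  assumes "0 < a" "admissible p"
  shows partial_inverse_moment_ge: "(max_value a p)\<^sup>2 / a * R_const a \<le> partial_inverse_moment a p"
    and partial_inverse_moment_eq_iff:
      "partial_inverse_moment a p = (max_value a p)\<^sup>2 / a * R_const a \<longleftrightarrow> single_factor_form p"
proof -
  interpret lobe a "first_zero p" "profile p" by (rule lobe_profile[OF assms])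
  note eqs = partial_inverse_moment_def max_value_def max_point_eq[OF assms] Phi_eq_F[OF assms]
  show "(max_value a p)\<^sup>2 / a * R_const a \<le> partial_inverse_moment a p"
    unfolding eqs by (rule partial_moment_ge)
  show "partial_inverse_moment a p = (max_value a p)\<^sup>2 / a * R_const a \<longleftrightarrow> single_factor_form p"
  proof (cases "single_factor_form p")
    case True
    then obtain c z where "\<And>u. ereal u < first_zero p \<Longrightarrow> profile p u = c * (1 - u / z)"
      using affine_profile[OF assms] by blast
    from partial_moment_eq[OF this] True show ?thesis unfolding eqs by simp
  next
    case False
    then show ?thesis
      using partial_moment_greater[OF strictly_midconvex_on_profile[OF assms False]]
      unfolding eqs by simp
  qed
qed

lemma max_value_squared_less:
  assumes "0 < a" "admissible p" "inverse_moment a p < \<infinity>"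
  shows "(max_value a p)\<^sup>2 < a * enn2real (inverse_moment a p) / R_star a"
proof -
  interpret lobe a "first_zero p" "profile p" by (rule lobe_profile[OF assms(1,2)])
  obtain x y c where xy: "(1 + 2 / a) * peak \<le> x" "x < y" "ereal y \<le> endpoint p"
    and c: "0 < c" "\<And>u. u \<in> {x<..<y} \<Longrightarrow> c \<le> \<bar>profile p u\<bar>"
    using profile_bounded_below[OF assms(1,2) tangent_zero_le] by blast
  have "0 < (1 + 2 / a) * peak" using assms(1) peak_pos by (simp add: add_pos_pos)
  then have x: "0 < x" using xy(1) by linarith
  have "{0<..<y} \<subseteq> {u. 0 < u \<and> ereal u < endpoint p}"
    using xy(3) by (auto intro: less_le_trans[of "ereal _" "ereal y"])
  then have "{x<..<y} \<subseteq> {u. 0 < u \<and> ereal u < endpoint p}"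
    "{0<..<x} \<subseteq> {u. 0 < u \<and> ereal u < endpoint p}"
    using x xy(2) by (auto simp: subset_iff)
  from moment_greater[OF xy(1,2) this c] show ?thesis
    using assms(3)
    unfolding inverse_moment_def max_value_def max_point_eq[OF assms(1,2)] Phi_eq_F[OF assms(1,2)]
    by blast
qed

theorem proposition5p3:
  fixes a :: real
  assumes "a > 0"
  shows
    "(\<comment> \<open>(E)\<close>
      \<forall>p. admissible p \<longrightarrow> (\<forall>t\<in>{0..1 + 2 / a}.
        Phi a p (t * max_point a p) / max_value a p \<ge> t powr (a / 2) * (1 + a / 2 * (1 - t)))) \<and>
     (\<comment> \<open>(M)\<close>
      \<forall>p. admissible p \<longrightarrow>
        partial_inverse_moment a p \<ge> (max_value a p)\<^sup>2 / a * R_const a) \<and>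
     (\<comment> \<open>(P)\<close>
      \<forall>p. admissible p \<and> inverse_moment a p < \<infinity> \<longrightarrow>
        (max_value a p)\<^sup>2 < a * enn2real (inverse_moment a p) / R_star a) \<and>
     (\<comment> \<open>(1)\<close>
      \<forall>t\<in>{0..1 + 2 / a}. \<forall>c > t powr (a / 2) * (1 + a / 2 * (1 - t)).
        \<not> (\<forall>p. admissible p \<longrightarrow> Phi a p (t * max_point a p) / max_value a p \<ge> c)) \<and>
     (\<comment> \<open>(2)\<close>
      \<forall>c > R_const a.
        \<not> (\<forall>p. admissible p \<longrightarrow> partial_inverse_moment a p \<ge> (max_value a p)\<^sup>2 / a * c)) \<and>
     (\<forall>p. admissible p \<longrightarrow>
        (partial_inverse_moment a p = (max_value a p)\<^sup>2 / a * R_const a \<longleftrightarrow>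
         single_factor_form p)) \<and>
     (\<comment> \<open>(3)\<close>
      \<forall>c > R_star a.
        \<not> (\<forall>p. admissible p \<and> inverse_moment a p < \<infinity> \<longrightarrow>
              (max_value a p)\<^sup>2 < a * enn2real (inverse_moment a p) / c)) \<and>
     (\<forall>p. admissible p \<and> inverse_moment a p < \<infinity> \<longrightarrow>
        (max_value a p)\<^sup>2 \<noteq> a * enn2real (inverse_moment a p) / R_star a) \<and>
     (\<comment> \<open>extremizing sequence in the finite-endpoint family with one zero\<close>
      \<exists>C lam B b \<zeta>.
        let p = (\<lambda>n::nat. Finite_Endpoint (C n) (lam n) (B n) (b n) 1 (\<zeta> n)) in
          (\<forall>n. admissible (p n) \<and> inverse_moment a (p n) < \<infinity>) \<and>
          (\<lambda>n. a * enn2real (inverse_moment a (p n)) / (max_value a (p n))\<^sup>2)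
            \<longlonglongrightarrow> R_star a)"
proof (intro conjI allI ballI impI)
  note a = assms
  show "t powr (a / 2) * (1 + a / 2 * (1 - t)) \<le> Phi a p (t * max_point a p) / max_value a p"
    if "admissible p" "t \<in> {0..1 + 2 / a}" for p t
    using lobe_ratio_ge[OF a] that by blast
  show "(max_value a p)\<^sup>2 / a * R_const a \<le> partial_inverse_moment a p" if "admissible p" for p
    using partial_inverse_moment_ge[OF a that] .
  show "(max_value a p)\<^sup>2 < a * enn2real (inverse_moment a p) / R_star a"
    and "(max_value a p)\<^sup>2 \<noteq> a * enn2real (inverse_moment a p) / R_star a"
    if "admissible p \<and> inverse_moment a p < \<infinity>" for p
    using max_value_squared_less[OF a, of p] that by auto
  show "partial_inverse_moment a p = (max_value a p)\<^sup>2 / a * R_const a \<longleftrightarrow> single_factor_form p"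
    if "admissible p" for p
    using partial_inverse_moment_eq_iff[OF a that] .
  \<comment> \<open>This one function is extremal for every t in (1) and also for (2).\<close>
  have adm: "admissible (one_zero 2)" by (rule admissible_one_zero) simp
  show "\<not> (\<forall>p. admissible p \<longrightarrow> c \<le> Phi a p (t * max_point a p) / max_value a p)"
    if "t \<in> {0..1 + 2 / a}" "t powr (a / 2) * (1 + a / 2 * (1 - t)) < c" for t c
    using lobe_ratio_eq_one_zero[OF a that(1)] that(2) adm by force
  show "\<not> (\<forall>p. admissible p \<longrightarrow> (max_value a p)\<^sup>2 / a * c \<le> partial_inverse_moment a p)"
    if "R_const a < c" for c
  proof
    assume "\<forall>p. admissible p \<longrightarrow> (max_value a p)\<^sup>2 / a * c \<le> partial_inverse_moment a p"
    then have "(max_value a (one_zero 2))\<^sup>2 / a * c \<le> (max_value a (one_zero 2))\<^sup>2 / a * R_const a"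
      using partial_inverse_moment_eq_iff[OF a adm] single_factor_one_zero[of 2] adm by auto
    moreover have "0 < (max_value a (one_zero 2))\<^sup>2 / a" using max_value_pos[OF a adm] a by simp
    ultimately show False using that by (simp only: mult_le_cancel_left_pos not_le)
  qed
  define p where "p = (\<lambda>n::nat. one_zero (1 + 1 / real (Suc n)))"
  have ext: "admissible (p n)" "inverse_moment a (p n) < \<infinity>"
    "(\<lambda>n. a * enn2real (inverse_moment a (p n)) / (max_value a (p n))\<^sup>2) \<longlonglongrightarrow> R_star a" for n
    unfolding p_def by (rule one_zero_extremizing[OF a])+
  show "\<exists>C lam B b \<zeta>. let p = (\<lambda>n::nat. Finite_Endpoint (C n) (lam n) (B n) (b n) 1 (\<zeta> n)) in
      (\<forall>n. admissible (p n) \<and> inverse_moment a (p n) < \<infinity>) \<and>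
      (\<lambda>n. a * enn2real (inverse_moment a (p n)) / (max_value a (p n))\<^sup>2) \<longlonglongrightarrow> R_star a"
    unfolding Let_def
    by (rule exI[of _ "\<lambda>_. 1"], rule exI[of _ "\<lambda>_. 0"], rule exI[of _ "\<lambda>n. 1 + 1 / real (Suc n)"],
        rule exI[of _ "\<lambda>_. 0"], rule exI[of _ "\<lambda>_ _. 1"])
       (use ext[unfolded p_def one_zero_def] in blast)
  show "\<not> (\<forall>p. admissible p \<and> inverse_moment a p < \<infinity> \<longrightarrow>
      (max_value a p)\<^sup>2 < a * enn2real (inverse_moment a p) / c)" if "R_star a < c" for c
  proof
    assume less: "\<forall>p. admissible p \<and> inverse_moment a p < \<infinity> \<longrightarrow>
      (max_value a p)\<^sup>2 < a * enn2real (inverse_moment a p) / c"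
    have "0 < R_star a" using a by (simp add: R_star_def)
    then have c: "0 < c" using that by simp
    \<comment> \<open>A valid constant \<open>c\<close> bounds every ratio along the one-zero
      sequence from below, hence also the limit \<open>R_star a\<close>.\<close>
    have "c \<le> a * enn2real (inverse_moment a (p n)) / (max_value a (p n))\<^sup>2" for n
    proof -
      have "(max_value a (p n))\<^sup>2 < a * enn2real (inverse_moment a (p n)) / c"
        using less[rule_format, of "p n"] ext(1,2) by simp
      then show ?thesis
        using c max_value_pos[OF a ext(1)[of n]]
        by (simp add: pos_less_divide_eq pos_le_divide_eq mult.commute)
    qed
    then have "c \<le> R_star a" by (intro LIMSEQ_le_const[OF ext(3)]) blast
    then show False using that by simp
  qed
qed

end
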